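(* Let $G$ be a finite solvable group and $H$ a subgroup of $G$. Then the number of maximal subgroups of $G$ strictly containing $H$ is less than $|G|/|H|$.
   Context: This is the relative version of Wall's conjecture for solvable groups. A maximal subgroup is a maximal proper subgroup. *)

theory Defs
  imports Complex_Main "HOL-Algebra.Solvable_Groups"
begin

definition maximal_subgroup :: "'a set \<Rightarrow> ('a, 'b) monoid_scheme \<Rightarrow> bool" where
  "maximal_subgroup M G \<longleftrightarrow>
     subgroup M G \<and> M \<noteq> carrier G \<and>
     (\<forall>K. subgroup K G \<longrightarrow> M \<subseteq> K \<longrightarrow> K = M \<or> K = carrier G)"

end

theory Submission
  imports Defs "HOL-Algebra.SndIsomorphismGrp"
begin

text \<open>
  Along a chief series every maximal subgroup \<open>M \<supseteq> H\<close> meets exactly one factor \<open>N / K\<close> with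
  \<open>K \<subseteq> M\<close> and \<open>N \<not>\<subseteq> M\<close>, and then \<open>M\<close> is a complement of that factor. There are at most
  \<open>|G : HK| - |G : HN|\<close> such \<open>M\<close>, and these bounds telescope to \<open>|G : H| - 1\<close>.

  The bound for a single factor is proved by induction on \<open>|G : K|\<close>. Let \<open>R / N\<close> be the next chief
  factor and attach to every complement \<open>M\<close> the group \<open>L = M \<inter> R\<close>. If \<open>[N, R] \<subseteq> K\<close>, each \<open>L\<close> is
  normal in \<open>G\<close> and the induction hypothesis applies to the factor \<open>R / L\<close>. Otherwise \<open>L\<close> determines \<open>M\<close>,
  and the \<open>L / K\<close> are abelian complements of \<open>N / K\<close> in \<open>R / K\<close>, which correspond to derivations
  \<open>L / K \<rightarrow> N / K\<close>; since no nontrivial element of \<open>N / K\<close> is centralised by \<open>L\<close>, there are at most \<open>|N / K|\<close>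
  of them.
\<close>

section \<open>Abelian complements of abelian normal subgroups\<close>

text \<open>
  In cohomological terms: the first Koszul cohomology of commuting operators on a finite module
  vanishes if their common kernel is trivial. The induction passes to the kernel and the image of one
  of the operators, on both of which the common kernel is again trivial.
\<close>

lemma (in comm_group) card_compatible_families:
  assumes "finite I" "finite W" "subgroup W G"
    and "\<And>x w. x \<in> I \<Longrightarrow> w \<in> W \<Longrightarrow> T x w \<in> W"
    and "\<And>x v w. x \<in> I \<Longrightarrow> v \<in> W \<Longrightarrow> w \<in> W \<Longrightarrow> T x (v \<otimes> w) = T x v \<otimes> T x w"
    and "\<And>x y w. x \<in> I \<Longrightarrow> y \<in> I \<Longrightarrow> w \<in> W \<Longrightarrow> T x (T y w) = T y (T x w)"
    and "\<And>w. w \<in> W \<Longrightarrow> (\<And>x. x \<in> I \<Longrightarrow> T x w = \<one>) \<Longrightarrow> w = \<one>"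
  shows "card {f \<in> I \<rightarrow>\<^sub>E W. \<forall>x\<in>I. \<forall>y\<in>I. T x (f y) = T y (f x)} \<le> card W"
  using assms(2-)
proof (induction "card W" arbitrary: W rule: less_induct)
  case less
  note mem = less.prems(3) and mult = less.prems(4) and comm = less.prems(5) and ker = less.prems(6)
  \<comment> \<open>The value set is a parameter because the count for \<open>W\<close> is reduced
    to the counts for the kernel and the image of one operator.\<close>
  define Z where "Z X = {f \<in> I \<rightarrow>\<^sub>E X. \<forall>x\<in>I. \<forall>y\<in>I. T x (f y) = T y (f x)}" for X
  have finZ: "finite (Z X)" if "finite X" for X
    unfolding Z_def using finite_PiE[OF assms(1), of "\<lambda>_. X"] that by simp
  have Zext: "f \<in> I \<rightarrow>\<^sub>E X" if "f \<in> Z X" for f X using that by (simp add: Z_def)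
  have Zmem: "f y \<in> X" if "f \<in> Z X" "y \<in> I" for f y X
    using PiE_mem[OF Zext[OF that(1)] that(2)] .
  have Zcomm: "T x (f y) = T y (f x)" if "f \<in> Z X" "x \<in> I" "y \<in> I" for f x y X
    using that unfolding Z_def by blast
  interpret W: subgroup W G by (rule less.prems(2))
  have Wc: "w \<in> carrier G" if "w \<in> W" for w using that by simp
  have T1: "T x \<one> = \<one>" if "x \<in> I" for x
    using mult[OF that W.one_closed W.one_closed] Wc[OF mem[OF that W.one_closed]] by simp
  have Tinv: "T x (inv w) = inv (T x w)" if "x \<in> I" "w \<in> W" for x w
  proof -
    have "T x (inv w) \<otimes> T x w = \<one>"
      using mult[OF that(1) _ that(2), of "inv w"] that T1 by simp
    then show ?thesis using mem[OF that(1)] that(2) by (simp add: inv_equality)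
  qed
  show ?case
  proof (cases "W = {\<one>}")
    case True
    have "Z W \<subseteq> {\<lambda>x\<in>I. \<one>}"
    proof
      fix f assume f: "f \<in> Z W"
      have "f = (\<lambda>x\<in>I. \<one>)"
        by (rule PiE_ext[OF Zext[OF f], of "\<lambda>x\<in>I. \<one>"]) (use Zmem[OF f] True in auto)
      then show "f \<in> {\<lambda>x\<in>I. \<one>}" by simp
    qed
    then have "card (Z W) \<le> card {\<lambda>x\<in>I. \<one>}" by (intro card_mono) auto
    then show ?thesis unfolding Z_def True by simp
  next
    case False
    then obtain w where w: "w \<in> W" "w \<noteq> \<one>" using W.one_closed by blast
    then obtain a where a: "a \<in> I" "T a w \<noteq> \<one>" using ker by blast
    \<comment> \<open>Kernel and image of an operator that is nontrivial on \<open>W\<close>. The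
      kernel is proper by the choice of \<open>a\<close>; once it is nontrivial, the image is
      smaller than \<open>W\<close> as well, so the induction applies to both.\<close>
    define W1 where "W1 = {v \<in> W. T a v = \<one>}"
    define W2 where "W2 = T a ` W"
    have sub1: "subgroup W1 G"
    proof (rule subgroupI)
      show "W1 \<noteq> {}" using T1[OF a(1)] W.one_closed unfolding W1_def by blast
      show "inv v \<in> W1" if "v \<in> W1" for v using that Tinv[OF a(1), of v] by (simp add: W1_def)
      show "u \<otimes> v \<in> W1" if "u \<in> W1" "v \<in> W1" for u v
        using that mult[OF a(1), of u v] by (simp add: W1_def)
    qed (auto simp: W1_def)
    have sub2: "subgroup W2 G"
    proof (rule subgroupI)
      show "W2 \<subseteq> carrier G" unfolding W2_def using mem[OF a(1)] W.subset by blast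
      show "W2 \<noteq> {}" using w by (auto simp: W2_def)
      show "inv x \<in> W2" if "x \<in> W2" for x
      proof -
        obtain u where "u \<in> W" "x = T a u" using \<open>x \<in> W2\<close> by (auto simp: W2_def)
        then have "inv x = T a (inv u)" using Tinv[OF a(1)] by simp
        then show ?thesis unfolding W2_def using \<open>u \<in> W\<close> by blast
      qed
      show "x \<otimes> y \<in> W2" if "x \<in> W2" "y \<in> W2" for x y
      proof -
        obtain u v where "u \<in> W" "v \<in> W" "x = T a u" "y = T a v" using \<open>x \<in> W2\<close> \<open>y \<in> W2\<close> by (auto simp: W2_def)
        then have "x \<otimes> y = T a (u \<otimes> v)" using mult[OF a(1)] by simp
        then show ?thesis unfolding W2_def using \<open>u \<in> W\<close> \<open>v \<in> W\<close> by blast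
      qed
    qed
    have W1W: "W1 \<subset> W" using w a by (auto simp: W1_def)
    have W2W: "W2 \<subseteq> W" using mem[OF a(1)] by (auto simp: W2_def)
    have fin: "finite W1" "finite W2" using less.prems(1) by (auto simp: W1_def W2_def)
    show ?thesis
    proof (cases "W1 = {\<one>}")
      case True
      have injT: "u = v" if "u \<in> W" "v \<in> W" "T a u = T a v" for u v
      proof -
        have "T a (u \<otimes> inv v) = \<one>" using that mult[OF a(1), of u "inv v"] Tinv[OF a(1), of v] mem[OF a(1), of v] by simp
        then have "u \<otimes> inv v \<in> W1" using that by (simp add: W1_def)
        then have "u \<otimes> inv v = \<one>" using True by simp
        moreover have "u \<otimes> inv v \<otimes> v = u" using that by (simp add: m_assoc)
        ultimately show "u = v" using that by simp
      qed
      \<comment> \<open>Since \<open>T a (f y) = T y (f a)\<close> and \<open>T a\<close> is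
        injective here, a family is determined by its value at \<open>a\<close>.\<close>
      have "inj_on (\<lambda>f. f a) (Z W)"
      proof (rule inj_onI)
        fix f g assume fg: "f \<in> Z W" "g \<in> Z W" "f a = g a"
        show "f = g"
        proof (rule PiE_ext[of f I "\<lambda>_. W" g])
          show "f \<in> I \<rightarrow>\<^sub>E W" "g \<in> I \<rightarrow>\<^sub>E W" using Zext[OF fg(1)] Zext[OF fg(2)] .
          fix y assume y: "y \<in> I"
          have "T a (f y) = T y (f a)" "T a (g y) = T y (g a)" using Zcomm[OF fg(1) a(1) y] Zcomm[OF fg(2) a(1) y] .
          with fg(3) have "T a (f y) = T a (g y)" by simp
          moreover have "f y \<in> W" "g y \<in> W" using Zmem fg(1,2) y by blast+
          ultimately show "f y = g y" by (rule injT[rotated 2])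
        qed
      qed
      moreover have "(\<lambda>f. f a) ` Z W \<subseteq> W" using Zmem[OF _ a(1)] by blast
      ultimately have "card (Z W) \<le> card W" using less.prems(1) by (rule card_inj_on_le)
      then show ?thesis by (simp add: Z_def)
    next
      case False
      have "\<exists>v\<in>W1. v \<noteq> \<one>" using False subgroup.one_closed[OF sub1] by auto
      have card12: "card W1 * card W2 \<le> card W"
      proof -
        \<comment> \<open>A section of \<open>T a\<close> over its image: applying
          \<open>T a\<close> to \<open>u \<otimes> s b\<close> recovers \<open>b\<close>, and then
          \<open>u\<close> follows by cancellation.\<close>
        define s where "s b = (SOME v. v \<in> W \<and> T a v = b)" for b
        have s: "s b \<in> W \<and> T a (s b) = b" if "b \<in> W2" for b
          unfolding s_def by (rule someI_ex) (use that in \<open>auto simp: W2_def\<close>)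
        have Ts: "T a (u \<otimes> s b) = b" if "u \<in> W1" "b \<in> W2" for u b
          using that s[of b] mult[OF a(1), of u "s b"] W2W by (auto simp: W1_def)
        have "inj_on (\<lambda>(u, b). u \<otimes> s b) (W1 \<times> W2)"
        proof (rule inj_onI, clarsimp)
          fix u b u' b' assume h: "u \<in> W1" "b \<in> W2" "u' \<in> W1" "b' \<in> W2" "u \<otimes> s b = u' \<otimes> s b'"
          have "b = b'" using Ts[OF h(1,2)] Ts[OF h(3,4)] h(5) by simp
          moreover have "u \<in> carrier G" "u' \<in> carrier G" using h by (auto simp: W1_def)
          ultimately show "u = u' \<and> b = b'" using h(5) s[OF h(2)] by auto
        qed
        moreover have "(\<lambda>(u, b). u \<otimes> s b) ` (W1 \<times> W2) \<subseteq> W"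
          using s by (auto simp: W1_def)
        ultimately have "card (W1 \<times> W2) \<le> card W" using less.prems(1) by (rule card_inj_on_le)
        then show ?thesis by (simp add: card_cartesian_product)
      qed
      have "2 \<le> card W1"
      proof -
        obtain v where "v \<in> W1" "v \<noteq> \<one>" using \<open>\<exists>v\<in>W1. v \<noteq> \<one>\<close> by blast
        then have "card {\<one>, v} \<le> card W1"
          using subgroup.one_closed[OF sub1] by (intro card_mono fin) auto
        with \<open>v \<noteq> \<one>\<close> show ?thesis by simp
      qed
      have "0 < card W2" using fin subgroup.one_closed[OF sub2] by (auto simp: card_gt_0_iff)
      with \<open>2 \<le> card W1\<close> have "card W2 < card W1 * card W2" by simp
      then have lt2: "card W2 < card W" using card12 by linarith
      have lt1: "card W1 < card W" using W1W less.prems(1) by (simp add: psubset_card_mono)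
      \<comment> \<open>Operators that commute with \<open>T a\<close> preserve its kernel and its
        image, and a trivial common kernel on \<open>W\<close> stays trivial on subgroups of
        \<open>W\<close>.\<close>
      have Z1: "card (Z W1) \<le> card W1"
        unfolding Z_def
      proof (rule less.hyps[OF lt1 fin(1) sub1])
        show "T x v \<in> W1" if "x \<in> I" "v \<in> W1" for x v
          using that a mem comm[OF a(1) \<open>x \<in> I\<close>] T1 by (auto simp: W1_def)
        show "T x (v \<otimes> w) = T x v \<otimes> T x w" if "x \<in> I" "v \<in> W1" "w \<in> W1" for x v w
          using that W1W mult[of x v w] by blast
        show "T x (T y w) = T y (T x w)" if "x \<in> I" "y \<in> I" "w \<in> W1" for x y w
          using that W1W comm[of x y w] by blast
        show "w = \<one>" if "w \<in> W1" "\<And>x. x \<in> I \<Longrightarrow> T x w = \<one>" for w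
          by (rule ker[OF _ that(2)]) (use that W1W in auto)
      qed
      have Z2: "card (Z W2) \<le> card W2"
        unfolding Z_def
      proof (rule less.hyps[OF lt2 fin(2) sub2])
        show "T x v \<in> W2" if "x \<in> I" "v \<in> W2" for x v
          using that a mem comm[OF \<open>x \<in> I\<close> a(1)] by (auto simp: W2_def)
        show "T x (v \<otimes> w) = T x v \<otimes> T x w" if "x \<in> I" "v \<in> W2" "w \<in> W2" for x v w
          using that W2W mult[of x v w] by blast
        show "T x (T y w) = T y (T x w)" if "x \<in> I" "y \<in> I" "w \<in> W2" for x y w
          using that W2W comm[of x y w] by blast
        show "w = \<one>" if "w \<in> W2" "\<And>x. x \<in> I \<Longrightarrow> T x w = \<one>" for w
          by (rule ker[OF _ that(2)]) (use that W2W in auto)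
      qed
      define \<Phi> where "\<Phi> f = (\<lambda>y\<in>I. T a (f y))" for f
      have \<Phi>: "\<Phi> f \<in> Z W2" if "f \<in> Z W" for f
      proof -
        have f: "f y \<in> W" if "y \<in> I" for y using Zmem[OF \<open>f \<in> Z W\<close> that] .
        have "T x (T a (f y)) = T y (T a (f x))" if "x \<in> I" "y \<in> I" for x y
          using comm[OF that(1) a(1) f[OF that(2)]] comm[OF that(2) a(1) f[OF that(1)]]
            Zcomm[OF \<open>f \<in> Z W\<close> that] by simp
        then show ?thesis using f by (auto simp: Z_def \<Phi>_def W2_def)
      qed
      define s where "s g = (SOME f. f \<in> Z W \<and> \<Phi> f = g)" for g
      have s: "s (\<Phi> f) \<in> Z W \<and> \<Phi> (s (\<Phi> f)) = \<Phi> f" if "f \<in> Z W" for f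
        unfolding s_def by (rule someI[of _ f]) (use that in simp)
      \<comment> \<open>The first component fixes the chosen family \<open>s (\<Phi> f)\<close>. It
        has the same image under \<open>T a\<close> as \<open>f\<close>, so the quotient of
        \<open>f\<close> by it takes values in the kernel \<open>W1\<close>. The two components
        together determine \<open>f\<close>.\<close>
      define \<Psi> where "\<Psi> f = (\<Phi> f, \<lambda>y\<in>I. f y \<otimes> inv (s (\<Phi> f) y))" for f
      have \<Psi>: "\<Psi> f \<in> Z W2 \<times> Z W1" if "f \<in> Z W" for f
      proof -
        define g where "g = s (\<Phi> f)"
        have g: "g \<in> Z W" "\<Phi> g = \<Phi> f" using s[OF that] by (auto simp: g_def)
        have fW: "f y \<in> W" "g y \<in> W" if "y \<in> I" for y
          using Zmem[OF \<open>f \<in> Z W\<close> that] Zmem[OF g(1) that] .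
        have Teq: "T a (f y) = T a (g y)" if "y \<in> I" for y
          using g(2) that by (auto simp: \<Phi>_def fun_eq_iff restrict_def split: if_splits)
        have "f y \<otimes> inv (g y) \<in> W1" if "y \<in> I" for y
          using fW[OF that] Teq[OF that] mult[OF a(1), of "f y" "inv (g y)"] Tinv[OF a(1), of "g y"]
            mem[OF a(1), of "g y"]
          by (simp add: W1_def)
        moreover have "T x (f y \<otimes> inv (g y)) = T y (f x \<otimes> inv (g x))" if "x \<in> I" "y \<in> I" for x y
          using mult[OF that(1), of "f y" "inv (g y)"] mult[OF that(2), of "f x" "inv (g x)"]
            Tinv[OF that(1), of "g y"] Tinv[OF that(2), of "g x"] fW[OF that(1)] fW[OF that(2)]
            Zcomm[OF \<open>f \<in> Z W\<close> that] Zcomm[OF g(1) that] by simp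
        ultimately show ?thesis using \<Phi>[OF that] unfolding \<Psi>_def g_def[symmetric]
          by (auto simp: Z_def)
      qed
      have "inj_on \<Psi> (Z W)"
      proof (rule inj_onI)
        fix f f' assume h: "f \<in> Z W" "f' \<in> Z W" "\<Psi> f = \<Psi> f'"
        then have e: "\<Phi> f' = \<Phi> f" by (simp add: \<Psi>_def)
        define g where "g = s (\<Phi> f)"
        have g: "g \<in> Z W" using s[OF h(1)] by (auto simp: g_def)
        show "f = f'"
        proof (rule PiE_ext[of f I "\<lambda>_. W" f'])
          show "f \<in> I \<rightarrow>\<^sub>E W" "f' \<in> I \<rightarrow>\<^sub>E W" using Zext[OF h(1)] Zext[OF h(2)] .
          fix y assume y: "y \<in> I"
          have "(\<lambda>y\<in>I. f y \<otimes> inv (g y)) = (\<lambda>y\<in>I. f' y \<otimes> inv (g y))"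
            using h(3) by (simp add: \<Psi>_def e g_def)
          then have "f y \<otimes> inv (g y) = f' y \<otimes> inv (g y)" using y by (auto dest: fun_cong[of _ _ y])
          moreover have "f y \<in> carrier G" "f' y \<in> carrier G" "inv (g y) \<in> carrier G"
            using Zmem[OF h(1) y] Zmem[OF h(2) y] Zmem[OF g y] by auto
          ultimately show "f y = f' y" by simp
        qed
      qed
      moreover have "\<Psi> ` Z W \<subseteq> Z W2 \<times> Z W1" using \<Psi> by (rule image_subsetI)
      ultimately have "card (Z W) \<le> card (Z W2 \<times> Z W1)"
        using finZ fin by (intro card_inj_on_le) auto
      also have "\<dots> \<le> card W2 * card W1"
        unfolding card_cartesian_product using Z1 Z2 by (rule mult_le_mono[rotated])
      also have "\<dots> \<le> card W" using card12 by (simp add: mult.commute)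
      finally show ?thesis by (simp add: Z_def)
    qed
  qed
qed

text \<open>A complement \<open>C\<close> is encoded by the function \<open>d C\<close> that
  multiplies each \<open>x \<in> L\<close> by an element of \<open>V\<close> so as to land in
  \<open>C\<close>. Commutativity of \<open>C\<close> and \<open>L\<close> makes \<open>d C\<close>
  a compatible family for the operators \<open>x - 1\<close> on \<open>V\<close>; by
  \<open>cent\<close> their common kernel is trivial, so there are at most \<open>card V\<close>
  such families.\<close>

lemma (in group) card_abelian_complements:
  assumes "V \<lhd> G" "finite V" and V_comm: "\<And>u v. u \<in> V \<Longrightarrow> v \<in> V \<Longrightarrow> u \<otimes> v = v \<otimes> u"
    and "L \<subseteq> carrier G" "finite L" and L_comm: "\<And>x y. x \<in> L \<Longrightarrow> y \<in> L \<Longrightarrow> x \<otimes> y = y \<otimes> x"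
    and cent: "\<And>v. v \<in> V \<Longrightarrow> (\<And>x. x \<in> L \<Longrightarrow> x \<otimes> v = v \<otimes> x) \<Longrightarrow> v = \<one>"
    and sub: "\<And>C. C \<in> S \<Longrightarrow> subgroup C G"
    and triv: "\<And>C. C \<in> S \<Longrightarrow> C \<inter> V = {\<one>}"
    and C_comm: "\<And>C x y. C \<in> S \<Longrightarrow> x \<in> C \<Longrightarrow> y \<in> C \<Longrightarrow> x \<otimes> y = y \<otimes> x"
    and prod: "\<And>C. C \<in> S \<Longrightarrow> V <#> C = V <#> L"
  shows "card S \<le> card V"
proof -
  interpret V: normal V G by (rule assms(1))
  interpret A: comm_group "G\<lparr>carrier := V\<rparr>"
    by (rule group.group_comm_groupI[OF subgroup_imp_group[OF V.is_subgroup]]) (simp add: V_comm)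
  have Lc: "x \<in> carrier G" if "x \<in> L" for x using that assms(4) by auto
  define \<phi> where "\<phi> x v = x \<otimes> v \<otimes> inv x" for x v
  have \<phi>V: "\<phi> x v \<in> V" if "x \<in> carrier G" "v \<in> V" for x v
    using that V.inv_op_closed2 by (simp add: \<phi>_def)
  have \<phi>m: "\<phi> x (u \<otimes> v) = \<phi> x u \<otimes> \<phi> x v" if "x \<in> carrier G" "u \<in> V" "v \<in> V" for x u v
  proof -
    have "inv x \<otimes> (x \<otimes> (v \<otimes> inv x)) = v \<otimes> inv x"
      using that by (simp flip: m_assoc)
    then show ?thesis using that by (simp add: \<phi>_def m_assoc)
  qed
  have \<phi>i: "\<phi> x (inv v) = inv (\<phi> x v)" if "x \<in> carrier G" "v \<in> V" for x v
    using that by (simp add: \<phi>_def inv_mult_group m_assoc)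
  have \<phi>c: "\<phi> x (\<phi> y v) = \<phi> (x \<otimes> y) v" if "x \<in> carrier G" "y \<in> carrier G" "v \<in> V" for x y v
    using that by (simp add: \<phi>_def inv_mult_group m_assoc)
  have V_lcomm: "u \<otimes> (v \<otimes> w) = v \<otimes> (u \<otimes> w)" if "u \<in> V" "v \<in> V" "w \<in> V" for u v w
    using that V_comm[of u v] by (simp flip: m_assoc)
  have cancel: "u \<otimes> (inv u \<otimes> w) = w" if "u \<in> V" "w \<in> V" for u w
    using that by (simp flip: m_assoc)
  \<comment> \<open>On the abelian group \<open>V\<close> this is the operator \<open>x - 1\<close>. If \<open>d x \<otimes> x\<close> and \<open>d y \<otimes> y\<close> lie in an abelian
    complement, comparing their two products gives \<open>T x (d y) = T y (d x)\<close>.\<close>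
  define T where "T x v = \<phi> x v \<otimes> inv v" for x v
  define Z where "Z = {f \<in> L \<rightarrow>\<^sub>E V. \<forall>x\<in>L. \<forall>y\<in>L. T x (f y) = T y (f x)}"
  have "card Z \<le> card V"
    unfolding Z_def
  proof (rule A.card_compatible_families[OF assms(5,2)])
    show "subgroup V (G\<lparr>carrier := V\<rparr>)" using A.subgroup_self by simp
    show "T x v \<in> V" if "x \<in> L" "v \<in> V" for x v
      using that \<phi>V Lc by (simp add: T_def)
    show "T x (u \<otimes>\<^bsub>G\<lparr>carrier := V\<rparr>\<^esub> v) = T x u \<otimes>\<^bsub>G\<lparr>carrier := V\<rparr>\<^esub> T x v"
      if "x \<in> L" "u \<in> V" "v \<in> V" for x u v
      using that \<phi>V[OF Lc] Lc
      by (simp add: T_def \<phi>m inv_mult_group m_assoc V_comm V_lcomm)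
    show "T x (T y v) = T y (T x v)" if "x \<in> L" "y \<in> L" "v \<in> V" for x y v
    proof -
      have "\<phi> x (\<phi> y v) = \<phi> y (\<phi> x v)" using that Lc L_comm[of x y] by (simp add: \<phi>c)
      then show ?thesis using that \<phi>V[OF Lc] Lc
        by (simp add: T_def \<phi>m \<phi>i inv_mult_group m_assoc V_comm V_lcomm)
    qed
    show "v = \<one>\<^bsub>G\<lparr>carrier := V\<rparr>\<^esub>"
      if v: "v \<in> V" "\<And>x. x \<in> L \<Longrightarrow> T x v = \<one>\<^bsub>G\<lparr>carrier := V\<rparr>\<^esub>" for v
    proof -
      have "x \<otimes> v = v \<otimes> x" if x: "x \<in> L" for x
      proof -
        have "x \<otimes> v = T x v \<otimes> v \<otimes> x" using v(1) Lc[OF x] by (simp add: T_def \<phi>_def m_assoc)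
        then show ?thesis using v x by simp
      qed
      then show ?thesis using cent v(1) by simp
    qed
  qed
  \<comment> \<open>The choice is possible because \<open>x\<close> lies in
    \<open>V <#> L = V <#> C\<close>.\<close>
  define d where "d C = (\<lambda>x\<in>L. SOME v. v \<in> V \<and> v \<otimes> x \<in> C)" for C
  have d: "d C x \<in> V \<and> d C x \<otimes> x \<in> C" if C: "C \<in> S" and x: "x \<in> L" for C x
  proof -
    have "\<one> \<otimes> x \<in> V <#> L" using V.one_closed x unfolding set_mult_def by blast
    then have "x \<in> V <#> C" using prod[OF C] Lc[OF x] by simp
    then obtain v c where vc: "v \<in> V" "c \<in> C" "x = v \<otimes> c" unfolding set_mult_def by blast
    have "c \<in> carrier G" using vc(2) sub[OF C] by (rule subgroup.mem_carrier[rotated])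
    then have "inv v \<otimes> x = c" using vc by (simp flip: m_assoc)
    then have "\<exists>v. v \<in> V \<and> v \<otimes> x \<in> C" using vc by (intro exI[of _ "inv v"]) auto
    from someI_ex[OF this] show ?thesis using x by (simp add: d_def)
  qed
  have dZ: "d C \<in> Z" if C: "C \<in> S" for C
  proof -
    have "T x (d C y) = T y (d C x)" if x: "x \<in> L" and y: "y \<in> L" for x y
    proof -
      define a b where "a = d C x" and "b = d C y"
      have ab: "a \<in> V" "b \<in> V" "a \<otimes> x \<in> C" "b \<otimes> y \<in> C"
        using d[OF C x] d[OF C y] by (auto simp: a_def b_def)
      have c: "x \<in> carrier G" "y \<in> carrier G" using x y Lc by auto
      \<comment> \<open>Moving \<open>x\<close> past \<open>b\<close> replaces \<open>b\<close> by
        its conjugate. The two products agree because \<open>C\<close> is commutative, and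
        \<open>x \<otimes> y\<close> cancels because elements of \<open>L\<close> commute; dividing
        by \<open>a\<close> and \<open>b\<close> inside \<open>V\<close> then gives
        compatibility.\<close>
      have *: "a \<otimes> x \<otimes> (b \<otimes> y) = a \<otimes> \<phi> x b \<otimes> (x \<otimes> y)" "b \<otimes> y \<otimes> (a \<otimes> x) = b \<otimes> \<phi> y a \<otimes> (y \<otimes> x)"
        using ab c by (simp_all add: \<phi>_def m_assoc inv_solve_left)
      have "a \<otimes> \<phi> x b \<otimes> (x \<otimes> y) = b \<otimes> \<phi> y a \<otimes> (x \<otimes> y)"
        using C_comm[OF C ab(3,4)] * L_comm[OF x y] by simp
      then have e: "a \<otimes> \<phi> x b = b \<otimes> \<phi> y a"
        using ab c \<phi>V by simp
      have "\<phi> x b \<otimes> inv b = inv a \<otimes> inv b \<otimes> (a \<otimes> \<phi> x b)"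
        using ab c \<phi>V by (simp add: m_assoc V_comm V_lcomm cancel)
      also have "\<dots> = \<phi> y a \<otimes> inv a"
        unfolding e using ab c \<phi>V by (simp add: m_assoc V_comm V_lcomm cancel)
      finally show ?thesis by (simp add: T_def a_def b_def)
    qed
    moreover have "d C \<in> L \<rightarrow>\<^sub>E V" using d[OF C] by (auto simp: d_def PiE_iff extensional_def)
    ultimately show ?thesis by (simp add: Z_def)
  qed
  \<comment> \<open>The family determines \<open>C\<close>, which gives injectivity of
    \<open>d\<close>: if \<open>v \<otimes> x\<close> is in \<open>C\<close>, it differs from
    \<open>d C x \<otimes> x\<close> by an element of \<open>C \<inter> V\<close>, which is
    trivial.\<close>
  have C_eq: "C = (\<lambda>x. d C x \<otimes> x) ` L" if C: "C \<in> S" for C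
  proof
    show "(\<lambda>x. d C x \<otimes> x) ` L \<subseteq> C" using d[OF C] by auto
    show "C \<subseteq> (\<lambda>x. d C x \<otimes> x) ` L"
    proof
      fix c assume c: "c \<in> C"
      interpret C: subgroup C G by (rule sub[OF C])
      have "\<one> \<otimes> c \<in> V <#> C" using V.one_closed c unfolding set_mult_def by blast
      then have "c \<in> V <#> L" using prod[OF C] c by simp
      then obtain v x where vx: "v \<in> V" "x \<in> L" "c = v \<otimes> x" unfolding set_mult_def by blast
      have dc: "d C x \<in> V" "d C x \<otimes> x \<in> C" using d[OF C vx(2)] by auto
      have "c \<otimes> inv (d C x \<otimes> x) = v \<otimes> inv (d C x)"
      proof -
        have "x \<otimes> (inv x \<otimes> inv (d C x)) = inv (d C x)"
          using dc(1) Lc[OF vx(2)] by (simp flip: m_assoc)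
        then show ?thesis using vx dc(1) Lc[OF vx(2)] by (simp add: inv_mult_group m_assoc)
      qed
      moreover have "c \<otimes> inv (d C x \<otimes> x) \<in> C" using c dc by simp
      ultimately have "v \<otimes> inv (d C x) \<in> C \<inter> V" using vx dc by simp
      then have "v \<otimes> inv (d C x) = \<one>" using triv[OF C] by blast
      moreover have "v \<otimes> inv (d C x) \<otimes> d C x = v" using vx dc by (simp add: m_assoc)
      ultimately have "v = d C x" using dc by simp
      then show "c \<in> (\<lambda>x. d C x \<otimes> x) ` L" using vx by blast
    qed
  qed
  have "inj_on d S"
  proof (rule inj_onI)
    fix C D assume CD: "C \<in> S" "D \<in> S" "d C = d D"
    have "C = (\<lambda>x. d D x \<otimes> x) ` L" using C_eq[OF CD(1)] unfolding CD(3) .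
    then show "C = D" using C_eq[OF CD(2)] by (rule trans[OF _ sym])
  qed
  moreover have "d ` S \<subseteq> Z" using dZ by blast
  moreover have "finite Z"
    unfolding Z_def using finite_PiE[OF assms(5), of "\<lambda>_. V"] assms(2) by simp
  ultimately have "card S \<le> card Z" by (rule card_inj_on_le)
  then show ?thesis using \<open>card Z \<le> card V\<close> by simp
qed

section \<open>Chief factors\<close>

text \<open>Equivalently, \<open>N / K\<close> is a minimal normal subgroup of \<open>G / K\<close>.
  Working with normal subgroups of \<open>G\<close> between \<open>K\<close> and \<open>N\<close>
  keeps quotient groups out of the statements and of the inductions.\<close>

definition chief_factor :: "('a, 'b) monoid_scheme \<Rightarrow> 'a set \<Rightarrow> 'a set \<Rightarrow> bool" where
  "chief_factor G K N \<longleftrightarrow> K \<lhd> G \<and> N \<lhd> G \<and> K \<subset> N \<and>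
     (\<forall>Y. Y \<lhd> G \<longrightarrow> K \<subseteq> Y \<longrightarrow> Y \<subseteq> N \<longrightarrow> Y = K \<or> Y = N)"

text \<open>Bookkeeping for the central case of \<open>card_maximal_complements\<close>,
  cross-multiplied to stay in the natural numbers. The relation \<open>r * k = n * l\<close> says
  that \<open>(r - l) / r\<close> and \<open>(n - k) / n\<close> coincide, which turns a bound for
  the factor \<open>R / L\<close> into one for \<open>N / K\<close>.\<close>

lemma mult_le_by_cancel:
  fixes c a r l k n g s h :: nat
  assumes "c * (l * a * r) \<le> s * (g * (r - l) * h)" "s * h \<le> l" "r * k = n * l" "0 < l"
  shows "c * a * n \<le> g * (n - k)"
proof -
  have "c * (l * a * r) \<le> g * (r - l) * (s * h)" using assms(1) by (simp add: ac_simps)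
  also have "\<dots> \<le> g * (r - l) * l" using assms(2) by (rule mult_le_mono2)
  finally have "c * a * r \<le> g * (r - l)" using assms(4) by (simp add: ac_simps)
  then have "c * a * r * k \<le> g * (r - l) * k" by (rule mult_le_mono1)
  moreover have "(r - l) * k = (n - k) * l"
    unfolding diff_mult_distrib assms(3) by (simp only: mult.commute[of l k])
  ultimately have "c * a * (r * k) \<le> g * ((n - k) * l)" by (simp only: mult.assoc)
  then have "c * a * n * l \<le> g * (n - k) * l" unfolding assms(3) by (simp only: mult.assoc)
  then show ?thesis using assms(4) by simp
qed

context group
begin

lemma chief_factor_exists:
  assumes "finite (carrier G)" "K \<lhd> G" "K \<noteq> carrier G"
  shows "\<exists>N. chief_factor G K N"
proof -
  let ?A = "{N. N \<lhd> G \<and> K \<subset> N}"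
  have sub: "N \<subseteq> carrier G" if "N \<lhd> G" for N
    using normal_imp_subgroup[OF that] by (rule subgroup.subset)
  have "finite ?A"
    by (rule finite_subset[of _ "Pow (carrier G)"]) (use sub assms(1) in auto)
  moreover have "carrier G \<in> ?A" using normal_self sub[OF assms(2)] assms(3) by auto
  ultimately obtain N where N: "N \<in> ?A" "\<forall>Y\<in>?A. Y \<subseteq> N \<longrightarrow> N = Y"
    using finite_has_minimal[of ?A] by blast
  then have "chief_factor G K N" unfolding chief_factor_def using assms(2) by blast
  then show ?thesis by blast
qed

section \<open>Products of subgroups\<close>

lemma set_mult_subgroups:
  assumes "N \<lhd> G" "subgroup M G"
  shows "subgroup (N <#> M) G" "N \<subseteq> N <#> M" "M \<subseteq> N <#> M"
proof -
  interpret second_isomorphism_grp N G M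
    using assms by (simp add: second_isomorphism_grp_def second_isomorphism_grp_axioms_def)
  show "subgroup (N <#> M) G" "N \<subseteq> N <#> M" "M \<subseteq> N <#> M"
    using normal_set_mult_subgroup H_contained_in_set_mult S_contained_in_set_mult by auto
qed

lemma set_mult_least:
  assumes "subgroup R G" "N \<subseteq> R" "M \<subseteq> R"
  shows "N <#> M \<subseteq> R"
  using assms subgroup.m_closed[OF assms(1)] unfolding set_mult_def by blast

text \<open>Dedekind's modular law: if \<open>n \<otimes> m\<close> is in \<open>R\<close> and
  \<open>n\<close> is in \<open>N \<subseteq> R\<close>, then \<open>m\<close> is in
  \<open>R\<close> too.\<close>

lemma set_mult_Int:
  assumes "subgroup R G" "subgroup M G" "N \<subseteq> R"
  shows "N <#> (M \<inter> R) = (N <#> M) \<inter> R"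
proof
  show "N <#> (M \<inter> R) \<subseteq> (N <#> M) \<inter> R"
    using assms(3) subgroup.m_closed[OF assms(1)] unfolding set_mult_def by blast
  show "(N <#> M) \<inter> R \<subseteq> N <#> (M \<inter> R)"
  proof
    fix r assume r: "r \<in> (N <#> M) \<inter> R"
    then obtain n m where nm: "n \<in> N" "m \<in> M" "r = n \<otimes> m" unfolding set_mult_def by blast
    have nR: "n \<in> R" using nm(1) assms(3) by blast
    have c: "n \<in> carrier G" "m \<in> carrier G"
      using subgroup.mem_carrier[OF assms(1) nR] subgroup.mem_carrier[OF assms(2) nm(2)] .
    then have "m = inv n \<otimes> r" using nm by (simp flip: m_assoc)
    moreover have "inv n \<otimes> r \<in> R"
      using r nR by (intro subgroup.m_closed[OF assms(1)] subgroup.m_inv_closed[OF assms(1)]) auto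
    ultimately have "m \<in> R" by simp
    then show "r \<in> N <#> (M \<inter> R)" using nm unfolding set_mult_def by blast
  qed
qed

text \<open>The multiplication map from \<open>A \<times> B\<close> onto \<open>A <#> B\<close> has
  fibres of equal size: the fibre over \<open>a \<otimes> b\<close> consists of the pairs
  \<open>(a \<otimes> c, inv c \<otimes> b)\<close> with
  \<open>c \<in> A \<inter> B\<close>.\<close>

lemma card_set_mult:
  assumes "finite (carrier G)" "subgroup A G" "subgroup B G"
  shows "card (A <#> B) * card (A \<inter> B) = card A * card B"
proof -
  interpret A: subgroup A G by fact
  interpret B: subgroup B G by fact
  have fin: "finite A" "finite B" using assms(1) A.subset B.subset finite_subset by auto
  have AB: "A <#> B = (\<lambda>(a, b). a \<otimes> b) ` (A \<times> B)" unfolding set_mult_def by auto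
  have fibre: "card {p \<in> A \<times> B. (\<lambda>(a, b). a \<otimes> b) p = g} = card (A \<inter> B)" if g: "g \<in> A <#> B" for g
  proof -
    obtain a b where ab: "a \<in> A" "b \<in> B" "g = a \<otimes> b" using g unfolding set_mult_def by blast
    have "bij_betw (\<lambda>c. (a \<otimes> c, inv c \<otimes> b)) (A \<inter> B) {p \<in> A \<times> B. (\<lambda>(a, b). a \<otimes> b) p = g}"
    proof (rule bij_betwI[where g = "\<lambda>(a', b'). inv a \<otimes> a'"])
      have "a \<otimes> c \<otimes> (inv c \<otimes> b) = a \<otimes> b" if "c \<in> A" for c
      proof -
        have "c \<otimes> (inv c \<otimes> b) = b" using that ab by (simp flip: m_assoc)
        then show ?thesis using that ab by (simp add: m_assoc)
      qed
      then show "(\<lambda>c. (a \<otimes> c, inv c \<otimes> b)) \<in> A \<inter> B \<rightarrow> {p \<in> A \<times> B. (\<lambda>(a, b). a \<otimes> b) p = g}"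
        using ab by auto
      have *: "inv a \<otimes> a' = b \<otimes> inv b'" if "a' \<in> A" "b' \<in> B" "a' \<otimes> b' = a \<otimes> b" for a' b'
      proof -
        have "inv a \<otimes> a' = inv a \<otimes> (a' \<otimes> b') \<otimes> inv b'" using that(1,2) ab by (simp add: m_assoc)
        also have "\<dots> = b \<otimes> inv b'"
          unfolding that(3) using that(1,2) ab by (simp flip: m_assoc)
        finally show ?thesis .
      qed
      show "(\<lambda>(a', b'). inv a \<otimes> a') \<in> {p \<in> A \<times> B. (\<lambda>(a, b). a \<otimes> b) p = g} \<rightarrow> A \<inter> B"
      proof
        fix p assume "p \<in> {p \<in> A \<times> B. (\<lambda>(a, b). a \<otimes> b) p = g}"
        then obtain a' b' where p: "p = (a', b')" "a' \<in> A" "b' \<in> B" "a' \<otimes> b' = a \<otimes> b" using ab by auto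
        have "inv a \<otimes> a' \<in> A" using p ab by simp
        moreover have "inv a \<otimes> a' \<in> B" unfolding *[OF p(2-4)] using p ab by simp
        ultimately show "(\<lambda>(a', b'). inv a \<otimes> a') p \<in> A \<inter> B" using p by simp
      qed
      show "(\<lambda>(a', b'). inv a \<otimes> a') (a \<otimes> c, inv c \<otimes> b) = c" if "c \<in> A \<inter> B" for c
        using that ab by (simp flip: m_assoc)
      show "(\<lambda>c. (a \<otimes> c, inv c \<otimes> b)) ((\<lambda>(a', b'). inv a \<otimes> a') p) = p"
        if p_in: "p \<in> {p \<in> A \<times> B. (\<lambda>(a, b). a \<otimes> b) p = g}" for p
      proof -
        obtain a' b' where p: "p = (a', b')" "a' \<in> A" "b' \<in> B" "a' \<otimes> b' = a \<otimes> b" using p_in ab by auto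
        have "a \<otimes> (inv a \<otimes> a') = a'" using p ab by (simp flip: m_assoc)
        moreover have "inv (inv a \<otimes> a') \<otimes> b = b'"
          unfolding *[OF p(2-4)] using p ab by (simp add: inv_mult_group m_assoc)
        ultimately show ?thesis using p by simp
      qed
    qed
    then show ?thesis by (simp add: bij_betw_same_card)
  qed
  have "card (A \<times> B) = (\<Sum>g\<in>A <#> B. card {p \<in> A \<times> B. (\<lambda>(a, b). a \<otimes> b) p = g})"
    unfolding AB using fin sum.image_gen[of "A \<times> B" "\<lambda>_. 1::nat" "\<lambda>(a, b). a \<otimes> b"] by simp
  also have "\<dots> = card (A <#> B) * card (A \<inter> B)" using fibre by simp
  finally show ?thesis by (simp add: card_cartesian_product)
qed

section \<open>Chief factors of solvable groups and their complements\<close>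

text \<open>Chief factors of a solvable group are abelian. With \<open>D\<close> the derived
  subgroup of \<open>N\<close>, the group \<open>K <#> D\<close> is \<open>K\<close> or
  \<open>N\<close>. In the second case the image of \<open>N\<close> in \<open>G / K\<close> would
  be perfect and so contained in every term of the derived series of \<open>G / K\<close>, which
  reaches the trivial group.\<close>

lemma chief_factor_commutator:
  assumes "solvable G" "chief_factor G K N" "a \<in> N" "b \<in> N"
  shows "a \<otimes> b \<otimes> inv a \<otimes> inv b \<in> K"
proof -
  have KN: "K \<lhd> G" "N \<lhd> G" "K \<subset> N"
    and chief: "\<And>Y. Y \<lhd> G \<Longrightarrow> K \<subseteq> Y \<Longrightarrow> Y \<subseteq> N \<Longrightarrow> Y = K \<or> Y = N"
    using assms(2) unfolding chief_factor_def by blast+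
  interpret K: normal K G by fact
  interpret N: normal N G by fact
  define Q where "Q = G Mod K"
  interpret Q: group Q unfolding Q_def by (rule K.factorgroup_is_group)
  interpret h: group_hom G Q "\<lambda>a. K #> a"
    by unfold_locales (use K.r_coset_hom_Mod in \<open>simp add: Q_def\<close>)
  have "solvable Q"
    by (rule h.surj_hom_imp_solvable[OF _ assms(1)]) (simp add: Q_def carrier_FactGroup)
  then obtain n where n: "(derived Q ^^ n) (carrier Q) = {\<one>\<^bsub>Q\<^esub>}"
    using Q.solvable_iff_trivial_derived_seq by blast
  define D where "D = derived G N"
  have D: "D \<lhd> G" unfolding D_def using KN(2) by (rule derived_is_normal)
  then interpret D: normal D G .
  have DN: "D \<subseteq> N" unfolding D_def by (rule derived_incl[OF subset_refl N.is_subgroup])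
  have inD: "a \<otimes> b \<otimes> inv a \<otimes> inv b \<in> D"
    unfolding D_def derived_def by (rule generate.incl) (use assms(3,4) in blast)
  have "K <#> D = K \<or> K <#> D = N"
    by (rule chief[OF normal_subgroup_set_mult_closed[OF KN(1) D]
          set_mult_subgroups(2)[OF KN(1) D.is_subgroup]
          set_mult_least[OF N.is_subgroup _ DN]]) (use KN(3) in blast)
  then show ?thesis
  proof
    assume "K <#> D = K"
    then show ?thesis using set_mult_subgroups(3)[OF KN(1) D.is_subgroup] inD by blast
  next
    assume KD: "K <#> D = N"
    \<comment> \<open>As \<open>N = K <#> D\<close>, the groups \<open>N\<close> and
      \<open>D\<close> have the same image in \<open>G / K\<close>; hence that image equals its own
      derived subgroup.\<close>
    have "(\<lambda>a. K #> a) ` N \<subseteq> (\<lambda>a. K #> a) ` D"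
    proof
      fix X assume "X \<in> (\<lambda>a. K #> a) ` N"
      then obtain k d where kd: "k \<in> K" "d \<in> D" "X = K #> (k \<otimes> d)"
        unfolding KD[symmetric] set_mult_def by blast
      have "X = K #> d"
        using coset_mult_assoc[OF K.subset, of k d] K.rcos_const[OF group_axioms kd(1)] kd by simp
      then show "X \<in> (\<lambda>a. K #> a) ` D" using kd(2) by blast
    qed
    then have "derived Q ((\<lambda>a. K #> a) ` N) = (\<lambda>a. K #> a) ` N"
      using h.derived_img[OF N.subset] DN by (simp add: D_def) blast
    then have "(derived Q ^^ n) ((\<lambda>a. K #> a) ` N) = (\<lambda>a. K #> a) ` N" by (induction n) auto
    moreover have "(derived Q ^^ n) ((\<lambda>a. K #> a) ` N) \<subseteq> (derived Q ^^ n) (carrier Q)"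
      using N.subset by (intro Q.mono_exp_of_derived) (auto simp: Q_def carrier_FactGroup)
    ultimately have "(\<lambda>a. K #> a) ` N \<subseteq> {K}" using n by (simp add: Q_def)
    then have "x \<in> K" if "x \<in> N" for x
      using that by (intro coset_join1[OF _ _ K.is_subgroup]) auto
    then show ?thesis using KN(3) by blast
  qed
qed

lemma conj_mem_if_commutator_mem:
  assumes "subgroup A G" "a \<in> A" "g \<in> carrier G" "g \<otimes> a \<otimes> inv g \<otimes> inv a \<in> A"
  shows "g \<otimes> a \<otimes> inv g \<in> A"
proof -
  have "g \<otimes> a \<otimes> inv g \<otimes> inv a \<otimes> a \<in> A" using assms(4,2) by (rule subgroup.m_closed[OF assms(1)])
  then show ?thesis using assms(3) subgroup.mem_carrier[OF assms(1,2)] by (simp add: m_assoc)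
qed

text \<open>Conjugation by \<open>n \<otimes> m\<close> is conjugation by \<open>m\<close> followed
  by conjugation by \<open>n\<close>, so the two factors of \<open>G\<close> can be treated by
  different arguments.\<close>

lemma normal_if_set_mult:
  assumes "subgroup A G" "N \<subseteq> carrier G" "M \<subseteq> carrier G" "N <#> M = carrier G"
    and "\<And>n a. n \<in> N \<Longrightarrow> a \<in> A \<Longrightarrow> n \<otimes> a \<otimes> inv n \<in> A"
    and "\<And>m a. m \<in> M \<Longrightarrow> a \<in> A \<Longrightarrow> m \<otimes> a \<otimes> inv m \<in> A"
  shows "A \<lhd> G"
  unfolding normal_inv_iff
proof (intro conjI ballI)
  fix x a assume "x \<in> carrier G" and a: "a \<in> A"
  then obtain n m where nm: "n \<in> N" "m \<in> M" "x = n \<otimes> m"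
    unfolding assms(4)[symmetric] set_mult_def by blast
  have c: "n \<in> carrier G" "m \<in> carrier G" "a \<in> carrier G"
    using nm assms(2,3) subgroup.mem_carrier[OF assms(1) a] by auto
  have "x \<otimes> a \<otimes> inv x = n \<otimes> (m \<otimes> a \<otimes> inv m) \<otimes> inv n"
    using c by (simp add: nm(3) inv_mult_group m_assoc)
  then show "x \<otimes> a \<otimes> inv x \<in> A" using assms(5,6) nm a by simp
qed fact

text \<open>\<open>N <#> M\<close> lies properly above \<open>M\<close>, so it is \<open>G\<close>
  by maximality. \<open>M\<close> normalises \<open>M \<inter> N\<close> because \<open>N\<close> is
  normal, and \<open>N\<close> does because \<open>N / K\<close> is abelian and
  \<open>K \<subseteq> M\<close>. So \<open>M \<inter> N\<close> is normal in \<open>G\<close>, and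
  minimality of the factor leaves only \<open>K\<close>.\<close>

lemma maximal_subgroup_complement:
  assumes "solvable G" "chief_factor G K N" "maximal_subgroup M G" "K \<subseteq> M" "\<not> N \<subseteq> M"
  shows "N <#> M = carrier G" "M \<inter> N = K"
proof -
  have KN: "K \<lhd> G" "N \<lhd> G" "K \<subset> N"
    and chief: "\<And>Y. Y \<lhd> G \<Longrightarrow> K \<subseteq> Y \<Longrightarrow> Y \<subseteq> N \<Longrightarrow> Y = K \<or> Y = N"
    using assms(2) unfolding chief_factor_def by blast+
  have M: "subgroup M G" and max: "\<And>Y. subgroup Y G \<Longrightarrow> M \<subseteq> Y \<Longrightarrow> Y = M \<or> Y = carrier G"
    using assms(3) unfolding maximal_subgroup_def by auto
  interpret N: normal N G by fact
  interpret M: subgroup M G by fact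
  show NM: "N <#> M = carrier G"
    using max[OF set_mult_subgroups(1,3)[OF KN(2) M]] set_mult_subgroups(2)[OF KN(2) M] assms(5)
    by blast
  have "M \<inter> N \<lhd> G"
  proof (rule normal_if_set_mult[OF _ N.subset M.subset NM])
    show "subgroup (M \<inter> N) G" using M N.is_subgroup by (rule subgroups_Inter_pair)
    fix a assume a: "a \<in> M \<inter> N"
    then have ac: "a \<in> carrier G" by auto
    show "n \<otimes> a \<otimes> inv n \<in> M \<inter> N" if n: "n \<in> N" for n
    proof -
      have "n \<otimes> a \<otimes> inv n \<otimes> inv a \<in> M"
        using chief_factor_commutator[OF assms(1,2) n, of a] a assms(4) by blast
      then have "n \<otimes> a \<otimes> inv n \<in> M" using M a n by (intro conj_mem_if_commutator_mem) auto
      then show ?thesis using n a by simp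
    qed
    show "m \<otimes> a \<otimes> inv m \<in> M \<inter> N" if m: "m \<in> M" for m
      using m a N.inv_op_closed2 by simp
  qed
  then have "M \<inter> N = K \<or> M \<inter> N = N" using chief KN(3) assms(4) by blast
  then show "M \<inter> N = K" using assms(5) by blast
qed

section \<open>Complements of chief factors\<close>

text \<open>With \<open>[a, b] = a b a^-1 b^-1\<close>, this is the identity
  \<open>[a, b c] = [a, b] (b [a, c] b^-1)\<close>. It extends commuting modulo \<open>K\<close>
  from \<open>N\<close> and \<open>L\<close> to their product \<open>R\<close>.\<close>

lemma commutator_mult_mem:
  assumes "K \<lhd> G" "a \<in> carrier G" "b \<in> carrier G" "c \<in> carrier G"
    and "a \<otimes> b \<otimes> inv a \<otimes> inv b \<in> K" "a \<otimes> c \<otimes> inv a \<otimes> inv c \<in> K"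
  shows "a \<otimes> (b \<otimes> c) \<otimes> inv a \<otimes> inv (b \<otimes> c) \<in> K"
proof -
  interpret K: normal K G by fact
  have cancel: "inv x \<otimes> (x \<otimes> y) = y" if "x \<in> carrier G" "y \<in> carrier G" for x y
    using that by (simp flip: m_assoc)
  have "a \<otimes> (b \<otimes> c) \<otimes> inv a \<otimes> inv (b \<otimes> c) =
      (a \<otimes> b \<otimes> inv a \<otimes> inv b) \<otimes> (b \<otimes> (a \<otimes> c \<otimes> inv a \<otimes> inv c) \<otimes> inv b)"
    using assms(2-4) by (simp add: m_assoc inv_mult_group cancel)
  then show ?thesis using assms(3,5,6) K.inv_op_closed2 by simp
qed

text \<open>The modular law cuts the complement \<open>M\<close> down to a complement of
  \<open>N / K\<close> in \<open>R / K\<close>. It is abelian modulo \<open>K\<close>: its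
  commutators lie in \<open>M\<close>, and also in \<open>N\<close> because \<open>R / N\<close> is
  abelian, hence in \<open>M \<inter> N = K\<close>.\<close>

lemma maximal_subgroup_Int_factor:
  assumes "solvable G" "chief_factor G K N" "chief_factor G N R"
    and "maximal_subgroup M G" "K \<subseteq> M" "\<not> N \<subseteq> M"
  shows "subgroup (M \<inter> R) G" "N <#> (M \<inter> R) = R" "(M \<inter> R) \<inter> N = K"
    and "\<And>m a. m \<in> M \<Longrightarrow> a \<in> M \<inter> R \<Longrightarrow> m \<otimes> a \<otimes> inv m \<in> M \<inter> R"
    and "\<And>a b. a \<in> M \<inter> R \<Longrightarrow> b \<in> M \<inter> R \<Longrightarrow> a \<otimes> b \<otimes> inv a \<otimes> inv b \<in> K"
proof -
  have nR: "R \<lhd> G" and NR: "N \<subseteq> R" using assms(3) by (auto simp: chief_factor_def)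
  interpret R: normal R G by fact
  interpret M: subgroup M G using assms(4) by (simp add: maximal_subgroup_def)
  note MN = maximal_subgroup_complement[OF assms(1,2,4-6)]
  show "subgroup (M \<inter> R) G" using M.subgroup_axioms R.is_subgroup by (rule subgroups_Inter_pair)
  show "N <#> (M \<inter> R) = R"
    using set_mult_Int[OF R.is_subgroup M.subgroup_axioms NR] MN(1) R.subset by auto
  show MRN: "(M \<inter> R) \<inter> N = K" using MN(2) NR by auto
  show "m \<otimes> a \<otimes> inv m \<in> M \<inter> R" if "m \<in> M" "a \<in> M \<inter> R" for m a
    using that R.inv_op_closed2 by simp
  show "a \<otimes> b \<otimes> inv a \<otimes> inv b \<in> K" if "a \<in> M \<inter> R" "b \<in> M \<inter> R" for a b
    using that chief_factor_commutator[OF assms(1,3), of a b] MN(2) by auto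
qed

section \<open>Complements of a chief factor not centralised by the next one\<close>

text \<open>Here \<open>M\<close> is determined by \<open>M \<inter> R\<close>, so it is enough to
  count the images of these intersections in \<open>G / K\<close>. They are abelian complements of
  \<open>N / K\<close> in \<open>R / K\<close>, at most \<open>card N / card K\<close> in number by
  \<open>card_abelian_complements\<close>.\<close>

lemma card_maximal_complements_noncentral:
  assumes "finite (carrier G)" "solvable G" "chief_factor G K N" "chief_factor G N R"
    and nc: "n0 \<in> N" "r0 \<in> R" "n0 \<otimes> r0 \<otimes> inv n0 \<otimes> inv r0 \<notin> K"
  shows "card {M. maximal_subgroup M G \<and> K \<subseteq> M \<and> \<not> N \<subseteq> M} * card K \<le> card N"
proof (cases "{M. maximal_subgroup M G \<and> K \<subseteq> M \<and> \<not> N \<subseteq> M} = {}")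
  case True
  show ?thesis unfolding True by simp
next
  case False
  define MM where "MM = {M. maximal_subgroup M G \<and> K \<subseteq> M \<and> \<not> N \<subseteq> M}"
  obtain M0 where M0: "M0 \<in> MM" using False by (auto simp: MM_def)
  have nK: "K \<lhd> G" and nN: "N \<lhd> G" and nR: "R \<lhd> G" and KN: "K \<subseteq> N" and NR: "N \<subseteq> R"
    and chief: "\<And>Y. Y \<lhd> G \<Longrightarrow> K \<subseteq> Y \<Longrightarrow> Y \<subseteq> N \<Longrightarrow> Y = K \<or> Y = N"
    using assms(3,4) unfolding chief_factor_def by blast+
  interpret K: normal K G by fact
  interpret N: normal N G by fact
  interpret R: normal R G by fact
  note commN = chief_factor_commutator[OF assms(2,3)]
  have fact: "subgroup (M \<inter> R) G" "N <#> (M \<inter> R) = R" "(M \<inter> R) \<inter> N = K"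
      "\<And>m a. m \<in> M \<Longrightarrow> a \<in> M \<inter> R \<Longrightarrow> m \<otimes> a \<otimes> inv m \<in> M \<inter> R"
      "\<And>a b. a \<in> M \<inter> R \<Longrightarrow> b \<in> M \<inter> R \<Longrightarrow> a \<otimes> b \<otimes> inv a \<otimes> inv b \<in> K"
    if "M \<in> MM" for M
    using that maximal_subgroup_Int_factor[OF assms(2,3,4), of M] by (simp_all add: MM_def)
  have max: "Y = M \<or> Y = carrier G" if "M \<in> MM" "subgroup Y G" "M \<subseteq> Y" for M Y
    using that unfolding MM_def maximal_subgroup_def by blast
  define h where "h = (\<lambda>a. K #> a)"
  define Q where "Q = G Mod K"
  interpret Q: group Q unfolding Q_def by (rule K.factorgroup_is_group)
  interpret h: group_hom G Q h
    by unfold_locales (use K.r_coset_hom_Mod in \<open>simp add: Q_def h_def\<close>)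
  have h_onto: "h ` carrier G = carrier Q" by (simp add: Q_def h_def carrier_FactGroup)
  have h_eqD: "\<exists>k\<in>K. x = k \<otimes> y" if "x \<in> carrier G" "y \<in> carrier G" "h x = h y" for x y
  proof -
    have "x \<in> K #> y" using rcos_self[OF that(1) K.is_subgroup] that(3) by (simp add: h_def)
    then show ?thesis unfolding r_coset_def by blast
  qed
  have h_one: "h k = \<one>\<^bsub>Q\<^esub>" if "k \<in> K" for k
    using K.rcos_const[OF group_axioms that] by (simp add: h_def Q_def)
  have h_comm: "h a \<otimes>\<^bsub>Q\<^esub> h b = h b \<otimes>\<^bsub>Q\<^esub> h a \<longleftrightarrow> a \<otimes> b \<otimes> inv a \<otimes> inv b \<in> K"
    if ab: "a \<in> carrier G" "b \<in> carrier G" for a b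
  proof -
    define c where "c = b \<otimes> a"
    have c: "c \<in> carrier G" using ab by (simp add: c_def)
    have ic: "a \<otimes> b \<otimes> inv a \<otimes> inv b = a \<otimes> b \<otimes> inv c"
      using ab by (simp add: c_def inv_mult_group m_assoc)
    have "h a \<otimes>\<^bsub>Q\<^esub> h b = h b \<otimes>\<^bsub>Q\<^esub> h a \<longleftrightarrow> h (a \<otimes> b) = h c"
      using ab by (simp add: c_def)
    also have "\<dots> \<longleftrightarrow> a \<otimes> b \<otimes> inv c \<in> K"
    proof
      assume "h (a \<otimes> b) = h c"
      then obtain k where k: "k \<in> K" "a \<otimes> b = k \<otimes> c" using h_eqD[OF m_closed[OF ab] c] by blast
      then show "a \<otimes> b \<otimes> inv c \<in> K" using c by (simp add: m_assoc)
    next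
      assume *: "a \<otimes> b \<otimes> inv c \<in> K"
      have "h (a \<otimes> b) = h (a \<otimes> b \<otimes> inv c \<otimes> c)" using ab c by (simp add: m_assoc)
      also have "\<dots> = h (a \<otimes> b \<otimes> inv c) \<otimes>\<^bsub>Q\<^esub> h c" using ab c by (intro h.hom_mult) auto
      also have "\<dots> = h c" unfolding h_one[OF *] using c by simp
      finally show "h (a \<otimes> b) = h c" .
    qed
    finally show ?thesis unfolding ic .
  qed
  have h_comm_img: "u \<otimes>\<^bsub>Q\<^esub> v = v \<otimes>\<^bsub>Q\<^esub> u"
    if uv: "u \<in> h ` A" "v \<in> h ` A" and A: "A \<subseteq> carrier G"
      "\<And>a b. a \<in> A \<Longrightarrow> b \<in> A \<Longrightarrow> a \<otimes> b \<otimes> inv a \<otimes> inv b \<in> K" for u v A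
  proof -
    obtain a b where ab: "a \<in> A" "b \<in> A" "u = h a" "v = h b" using uv by blast
    then have "a \<in> carrier G" "b \<in> carrier G" using A(1) by auto
    then show ?thesis using h_comm A(2)[OF ab(1,2)] ab(3,4) by blast
  qed
  have cR: "r \<in> carrier G" if "r \<in> R" for r using that by simp
  have cN: "n \<in> carrier G" if "n \<in> N" for n using that by simp

  have inj: "inj_on (\<lambda>M. h ` (M \<inter> R)) MM"
  proof (rule inj_onI, rule ccontr)
    fix M M' assume MM': "M \<in> MM" "M' \<in> MM" "h ` (M \<inter> R) = h ` (M' \<inter> R)" "M \<noteq> M'"
    \<comment> \<open>Both intersections contain \<open>K\<close>, so an inclusion between their
      images in \<open>G / K\<close> lifts to \<open>G\<close>.\<close>
    have sub: "M1 \<inter> R \<subseteq> M2 \<inter> R"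
      if M12: "M1 \<in> MM" "M2 \<in> MM" "h ` (M1 \<inter> R) \<subseteq> h ` (M2 \<inter> R)" for M1 M2
    proof
      fix x assume x: "x \<in> M1 \<inter> R"
      then obtain y where y: "y \<in> M2 \<inter> R" "h x = h y" using M12(3) by blast
      obtain k where k: "k \<in> K" "x = k \<otimes> y" using h_eqD[OF cR cR y(2)] x y(1) by blast
      have "k \<in> M2 \<inter> R" using fact(3)[OF M12(2)] k(1) by blast
      then show "x \<in> M2 \<inter> R" unfolding k(2) using y(1) by (rule subgroup.m_closed[OF fact(1)[OF M12(2)]])
    qed
    define L where "L = M \<inter> R"
    have LL: "L = M' \<inter> R" unfolding L_def
      using sub[OF MM'(1,2)] sub[OF MM'(2,1)] MM'(3) by (intro subset_antisym) simp_all
    interpret L: subgroup L G unfolding L_def by (rule fact(1)[OF MM'(1)])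
    \<comment> \<open>The normaliser of the common intersection \<open>L\<close>, with both
      conjugations required so that closure under inverses is immediate. It contains the two
      distinct maximal subgroups \<open>M\<close> and \<open>M'\<close>, so it is all of
      \<open>G\<close>.\<close>
    define Y where "Y = {g \<in> carrier G. \<forall>a\<in>L. g \<otimes> a \<otimes> inv g \<in> L \<and> inv g \<otimes> a \<otimes> g \<in> L}"
    have sY: "subgroup Y G"
    proof (rule subgroupI)
      show "Y \<subseteq> carrier G" by (auto simp: Y_def)
      have "\<one> \<in> Y" by (auto simp: Y_def)
      then show "Y \<noteq> {}" by blast
      show "inv g \<in> Y" if "g \<in> Y" for g using that by (auto simp: Y_def)
      show "g \<otimes> g' \<in> Y" if "g \<in> Y" "g' \<in> Y" for g g'
      proof -
        have c: "g \<in> carrier G" "g' \<in> carrier G" using that by (auto simp: Y_def)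
        have "(g \<otimes> g') \<otimes> a \<otimes> inv (g \<otimes> g') = g \<otimes> (g' \<otimes> a \<otimes> inv g') \<otimes> inv g"
          "inv (g \<otimes> g') \<otimes> a \<otimes> (g \<otimes> g') = inv g' \<otimes> (inv g \<otimes> a \<otimes> g) \<otimes> g'" if "a \<in> L" for a
          using c that by (simp_all add: inv_mult_group m_assoc)
        then show ?thesis using that c unfolding Y_def by simp
      qed
    qed
    have sub_Y: "M1 \<subseteq> Y" if "M1 \<in> MM" "L = M1 \<inter> R" for M1
    proof
      fix m assume m: "m \<in> M1"
      interpret M1: subgroup M1 G using that by (simp add: MM_def maximal_subgroup_def)
      have "inv m \<otimes> a \<otimes> m \<in> L" if "a \<in> L" for a
        using fact(4)[OF \<open>M1 \<in> MM\<close> M1.m_inv_closed[OF m], of a] that \<open>L = M1 \<inter> R\<close> m by simp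
      moreover have "m \<otimes> a \<otimes> inv m \<in> L" if "a \<in> L" for a
        using fact(4)[OF \<open>M1 \<in> MM\<close> m, of a] that \<open>L = M1 \<inter> R\<close> by simp
      ultimately show "m \<in> Y" using m by (simp add: Y_def)
    qed
    have "Y = M \<or> Y = carrier G" "Y = M' \<or> Y = carrier G"
      using max[OF MM'(1) sY sub_Y[OF MM'(1) L_def]] max[OF MM'(2) sY sub_Y[OF MM'(2) LL]] .
    then have Y: "Y = carrier G" using MM'(4) by blast
    \<comment> \<open>Once \<open>L\<close> is normal, commutators of \<open>n0\<close> with
      \<open>L\<close> lie in \<open>L \<inter> N = K\<close>. Since \<open>R = N <#> L\<close> and
      \<open>N / K\<close> is abelian, \<open>n0\<close> then commutes with \<open>r0\<close> modulo
      \<open>K\<close>, a contradiction.\<close>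
    have "n0 \<otimes> l \<otimes> inv n0 \<otimes> inv l \<in> K" if l: "l \<in> L" for l
    proof -
      have "n0 \<otimes> l \<otimes> inv n0 \<in> L" using Y l cN[OF nc(1)] unfolding Y_def by blast
      then have "n0 \<otimes> l \<otimes> inv n0 \<otimes> inv l \<in> L" using l by simp
      moreover have "n0 \<otimes> (l \<otimes> inv n0 \<otimes> inv l) \<in> N" using l nc(1) N.inv_op_closed2 by simp
      then have "n0 \<otimes> l \<otimes> inv n0 \<otimes> inv l \<in> N" using l cN[OF nc(1)] by (simp add: m_assoc)
      ultimately show ?thesis using fact(3)[OF MM'(1)] by (auto simp: L_def)
    qed
    moreover obtain n l where nl: "n \<in> N" "l \<in> L" "r0 = n \<otimes> l"
      using nc(2) fact(2)[OF MM'(1)] unfolding L_def set_mult_def by blast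
    ultimately have "n0 \<otimes> r0 \<otimes> inv n0 \<otimes> inv r0 \<in> K"
      unfolding nl(3) using nc(1) commN[OF nc(1) nl(1)] by (intro commutator_mult_mem[OF nK]) auto
    then show False using nc(3) by blast
  qed

  have "card ((\<lambda>M. h ` (M \<inter> R)) ` MM) \<le> card (h ` N)"
  proof (rule Q.card_abelian_complements[where L = "h ` (M0 \<inter> R)"])
    show "h ` N \<lhd> Q"
      using N.surj_hom_normal_subgroup[OF h.group_hom_axioms h_onto] .
    show "finite (h ` N)" using assms(1) N.subset finite_subset by blast
    show "u \<otimes>\<^bsub>Q\<^esub> v = v \<otimes>\<^bsub>Q\<^esub> u" if "u \<in> h ` N" "v \<in> h ` N" for u v
      using that N.subset commN by (rule h_comm_img)
    show "h ` (M0 \<inter> R) \<subseteq> carrier Q" using R.subset by auto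
    show "finite (h ` (M0 \<inter> R))" using assms(1) R.subset finite_subset by blast
    show "u \<otimes>\<^bsub>Q\<^esub> v = v \<otimes>\<^bsub>Q\<^esub> u" if "u \<in> h ` (M0 \<inter> R)" "v \<in> h ` (M0 \<inter> R)" for u v
      using that _ fact(5)[OF M0] by (rule h_comm_img) (use cR in auto)
    show "v = \<one>\<^bsub>Q\<^esub>"
      if v: "v \<in> h ` N" "\<And>x. x \<in> h ` (M0 \<inter> R) \<Longrightarrow> x \<otimes>\<^bsub>Q\<^esub> v = v \<otimes>\<^bsub>Q\<^esub> x" for v
    proof -
      obtain n where n: "n \<in> N" "v = h n" using v(1) by blast
      \<comment> \<open>The elements of \<open>N\<close> that centralise \<open>R\<close> modulo
        \<open>K\<close>. This is a normal subgroup of \<open>G\<close> between \<open>K\<close> and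
        \<open>N\<close> that misses \<open>n0\<close>, so it equals \<open>K\<close>.\<close>
      define Z where "Z = {n \<in> N. \<forall>r\<in>R. h n \<otimes>\<^bsub>Q\<^esub> h r = h r \<otimes>\<^bsub>Q\<^esub> h n}"
      have Zc: "z \<in> carrier G" if "z \<in> Z" for z using that by (auto simp: Z_def)
      have Zcomm: "h z \<otimes>\<^bsub>Q\<^esub> h r = h r \<otimes>\<^bsub>Q\<^esub> h z" if "z \<in> Z" "r \<in> R" for z r
        using that by (auto simp: Z_def)
      have sZ: "subgroup Z G"
      proof (rule subgroupI)
        show "Z \<subseteq> carrier G" using Zc by blast
        have "\<one> \<in> Z" using N.one_closed by (simp add: Z_def)
        then show "Z \<noteq> {}" by blast
        show "inv z \<in> Z" if z: "z \<in> Z" for z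
        proof -
          have "h (inv z) \<otimes>\<^bsub>Q\<^esub> h r = h r \<otimes>\<^bsub>Q\<^esub> h (inv z)" if r: "r \<in> R" for r
          proof -
            have "h r \<otimes>\<^bsub>Q\<^esub> h (inv z) = h (inv z) \<otimes>\<^bsub>Q\<^esub> (h z \<otimes>\<^bsub>Q\<^esub> h r) \<otimes>\<^bsub>Q\<^esub> h (inv z)"
              using Zc[OF z] r by (simp flip: Q.m_assoc)
            also have "\<dots> = h (inv z) \<otimes>\<^bsub>Q\<^esub> h r"
              unfolding Zcomm[OF z r] using Zc[OF z] r by (simp add: Q.m_assoc)
            finally show ?thesis by simp
          qed
          then show ?thesis using z by (simp add: Z_def)
        qed
        show "y \<otimes> z \<in> Z" if yz: "y \<in> Z" "z \<in> Z" for y z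
        proof -
          have "h (y \<otimes> z) \<otimes>\<^bsub>Q\<^esub> h r = h r \<otimes>\<^bsub>Q\<^esub> h (y \<otimes> z)" if r: "r \<in> R" for r
          proof -
            have "h (y \<otimes> z) \<otimes>\<^bsub>Q\<^esub> h r = h y \<otimes>\<^bsub>Q\<^esub> (h z \<otimes>\<^bsub>Q\<^esub> h r)"
              using Zc[OF yz(1)] Zc[OF yz(2)] r by (simp add: Q.m_assoc)
            also have "\<dots> = (h y \<otimes>\<^bsub>Q\<^esub> h r) \<otimes>\<^bsub>Q\<^esub> h z"
              unfolding Zcomm[OF yz(2) r] using Zc[OF yz(1)] Zc[OF yz(2)] r by (simp add: Q.m_assoc)
            also have "\<dots> = h r \<otimes>\<^bsub>Q\<^esub> h (y \<otimes> z)"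
              unfolding Zcomm[OF yz(1) r] using Zc[OF yz(1)] Zc[OF yz(2)] r by (simp add: Q.m_assoc)
            finally show ?thesis .
          qed
          then show ?thesis using yz by (simp add: Z_def)
        qed
      qed
      have "Z \<lhd> G" unfolding normal_inv_iff
      proof (intro conjI ballI sZ)
        fix g z assume g: "g \<in> carrier G" and z: "z \<in> Z"
        have "h (g \<otimes> z \<otimes> inv g) \<otimes>\<^bsub>Q\<^esub> h r = h r \<otimes>\<^bsub>Q\<^esub> h (g \<otimes> z \<otimes> inv g)" if r: "r \<in> R" for r
        proof -
          have r': "inv g \<otimes> r \<otimes> g \<in> R" using R.inv_op_closed1[OF g r] .
          note c = g Zc[OF z] cR[OF r] cR[OF r']
          have cancel: "g \<otimes> (inv g \<otimes> x) = x" if "x \<in> carrier G" for x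
            using that g by (simp flip: m_assoc)
          have "h (g \<otimes> z \<otimes> inv g) \<otimes>\<^bsub>Q\<^esub> h r = h (g \<otimes> z \<otimes> inv g \<otimes> r)" using c by simp
          also have "g \<otimes> z \<otimes> inv g \<otimes> r = g \<otimes> (z \<otimes> (inv g \<otimes> r \<otimes> g)) \<otimes> inv g"
            using c by (simp add: m_assoc)
          also have "h \<dots> = h g \<otimes>\<^bsub>Q\<^esub> (h z \<otimes>\<^bsub>Q\<^esub> h (inv g \<otimes> r \<otimes> g)) \<otimes>\<^bsub>Q\<^esub> h (inv g)"
            using c by (simp only: h.hom_mult m_closed inv_closed)
          also have "\<dots> = h (g \<otimes> ((inv g \<otimes> r \<otimes> g) \<otimes> z) \<otimes> inv g)"
            unfolding Zcomm[OF z r'] using c by (simp only: h.hom_mult m_closed inv_closed)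
          also have "g \<otimes> ((inv g \<otimes> r \<otimes> g) \<otimes> z) \<otimes> inv g = r \<otimes> (g \<otimes> z \<otimes> inv g)"
            using c by (simp add: m_assoc cancel)
          also have "h \<dots> = h r \<otimes>\<^bsub>Q\<^esub> h (g \<otimes> z \<otimes> inv g)"
            using c by (intro h.hom_mult) auto
          finally show ?thesis .
        qed
        moreover have "g \<otimes> z \<otimes> inv g \<in> N" using z g N.inv_op_closed2 by (simp add: Z_def)
        ultimately show "g \<otimes> z \<otimes> inv g \<in> Z" by (simp add: Z_def)
      qed
      moreover have "K \<subseteq> Z" using KN h_one cR by (auto simp: Z_def)
      moreover have "Z \<subseteq> N" by (auto simp: Z_def)
      ultimately have "Z = K \<or> Z = N" by (rule chief)
      moreover have "n0 \<notin> Z" using h_comm[OF cN[OF nc(1)] cR[OF nc(2)]] nc by (auto simp: Z_def)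
      ultimately have ZK: "Z = K" using nc(1) by blast
      \<comment> \<open>An element of \<open>N\<close> that centralises \<open>M0 \<inter> R\<close>
        modulo \<open>K\<close> also centralises \<open>N\<close> modulo \<open>K\<close>, hence all
        of \<open>R = N <#> (M0 \<inter> R)\<close>; so it belongs to \<open>Z = K\<close>.\<close>
      have "n \<otimes> r \<otimes> inv n \<otimes> inv r \<in> K" if r: "r \<in> R" for r
      proof -
        obtain m l where ml: "m \<in> N" "l \<in> M0 \<inter> R" "r = m \<otimes> l"
          using r fact(2)[OF M0] unfolding set_mult_def by blast
        have "n \<otimes> l \<otimes> inv n \<otimes> inv l \<in> K"
          using h_comm[of n l] v(2)[of "h l"] n ml(2) cN cR by auto
        then show ?thesis unfolding ml(3)
          using commN[OF n(1) ml(1)] n(1) ml(1,2) cR by (intro commutator_mult_mem[OF nK]) auto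
      qed
      then have "n \<in> Z" using n(1) h_comm cN cR by (simp add: Z_def)
      then show ?thesis using ZK n(2) h_one by simp
    qed
    fix C assume "C \<in> (\<lambda>M. h ` (M \<inter> R)) ` MM"
    then obtain M where M: "M \<in> MM" "C = h ` (M \<inter> R)" by blast
    show "subgroup C Q" unfolding M(2) by (rule h.subgroup_img_is_subgroup[OF fact(1)[OF M(1)]])
    show "x \<otimes>\<^bsub>Q\<^esub> y = y \<otimes>\<^bsub>Q\<^esub> x" if "x \<in> C" "y \<in> C" for x y
      using that[unfolded M(2)] _ fact(5)[OF M(1)] by (rule h_comm_img) (use cR in auto)
    have hR: "h ` N <#>\<^bsub>Q\<^esub> h ` (M' \<inter> R) = h ` R" if "M' \<in> MM" for M'
    proof -
      have "h ` N <#>\<^bsub>Q\<^esub> h ` (M' \<inter> R) = h ` (N <#> (M' \<inter> R))"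
        using N.subset R.subset by (intro set_mult_hom[OF h.homh, symmetric]) auto
      then show ?thesis using fact(2)[OF that] by simp
    qed
    show "h ` N <#>\<^bsub>Q\<^esub> C = h ` N <#>\<^bsub>Q\<^esub> h ` (M0 \<inter> R)"
      unfolding M(2) hR[OF M(1)] hR[OF M0] ..
    show "C \<inter> h ` N = {\<one>\<^bsub>Q\<^esub>}"
    proof
      show "{\<one>\<^bsub>Q\<^esub>} \<subseteq> C \<inter> h ` N"
        using subgroup.one_closed[OF h.subgroup_img_is_subgroup[OF fact(1)[OF M(1)]]]
          subgroup.one_closed[OF h.subgroup_img_is_subgroup[OF N.is_subgroup]] M(2) by simp
      show "C \<inter> h ` N \<subseteq> {\<one>\<^bsub>Q\<^esub>}"
      proof
        fix X assume "X \<in> C \<inter> h ` N"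
        then obtain x n where xn: "x \<in> M \<inter> R" "n \<in> N" "X = h x" "h x = h n" using M(2) by auto
        obtain k where k: "k \<in> K" "x = k \<otimes> n" using h_eqD[OF cR cN xn(4)] xn(1,2) by blast
        have "x \<in> N" unfolding k(2) using k(1) KN xn(2) by (intro N.m_closed) auto
        then have "x \<in> K" using fact(3)[OF M(1)] xn(1) by blast
        then show "X \<in> {\<one>\<^bsub>Q\<^esub>}" using h_one xn(3) by simp
      qed
    qed
  qed
  then have "card MM \<le> card (h ` N)" using card_image[OF inj] by simp
  moreover have "card (h ` N) * card K = card N"
  proof -
    have "h ` N = rcosets\<^bsub>G\<lparr>carrier := N\<rparr>\<^esub> K" by (auto simp: h_def RCOSETS_def)
    then show ?thesis
      using group.lagrange[OF subgroup_imp_group[OF N.is_subgroup]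
          subgroup_incl[OF K.is_subgroup N.is_subgroup KN]]
      by (simp add: order_def)
  qed
  ultimately show ?thesis unfolding MM_def[symmetric] by (metis mult_le_mono1)
qed

lemma double_card_le_subgroup:
  assumes "finite (carrier G)" "subgroup A G" "subgroup B G" "A \<subset> B"
  shows "2 * card A \<le> card B"
proof -
  have fin: "finite B" using assms(1,3) subgroup.subset finite_subset by blast
  define q where "q = card (rcosets\<^bsub>G\<lparr>carrier := B\<rparr>\<^esub> A)"
  have q: "q * card A = card B"
    using group.lagrange[OF subgroup_imp_group[OF assms(3)] subgroup_incl[OF assms(2,3)]] assms(4)
    by (simp add: q_def order_def psubset_eq)
  moreover have "card A < card B" using fin assms(4) by (rule psubset_card_mono)
  ultimately have "q \<noteq> 0" "q \<noteq> 1" by (intro notI; simp)+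
  then have "2 * card A \<le> q * card A" by (intro mult_le_mono1) linarith
  then show ?thesis using q by simp
qed

section \<open>Complements of a chief factor centralised by the next one\<close>

text \<open>\<open>L = M \<inter> R\<close> is normalised by \<open>M\<close>, and by
  \<open>N\<close> because the commutators of \<open>N\<close> with \<open>R\<close> lie in
  \<open>K \<subseteq> L\<close>; so it is normal in \<open>G = N <#> M\<close>. A normal
  \<open>Y\<close> between \<open>L\<close> and \<open>R\<close> meets \<open>N\<close> in
  \<open>N\<close> or \<open>K\<close>: in the first case \<open>Y\<close> contains
  \<open>N <#> L = R\<close>, in the second the modular law gives
  \<open>Y = K <#> L = L\<close>.\<close>

lemma central_complement_chief_factor:
  assumes "solvable G" "chief_factor G K N" "chief_factor G N R"
    and central: "\<And>n r. n \<in> N \<Longrightarrow> r \<in> R \<Longrightarrow> n \<otimes> r \<otimes> inv n \<otimes> inv r \<in> K"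
    and M: "maximal_subgroup M G" "K \<subseteq> M" "\<not> N \<subseteq> M"
  shows "chief_factor G (M \<inter> R) R"
proof -
  note MR = maximal_subgroup_Int_factor[OF assms(1-3) M]
  have nK: "K \<lhd> G" and nN: "N \<lhd> G" and nR: "R \<lhd> G" and KN: "K \<subset> N" and NR: "N \<subset> R"
    and chief: "\<And>Y. Y \<lhd> G \<Longrightarrow> K \<subseteq> Y \<Longrightarrow> Y \<subseteq> N \<Longrightarrow> Y = K \<or> Y = N"
    using assms(2,3) unfolding chief_factor_def by blast+
  interpret N: normal N G by fact
  interpret R: normal R G by fact
  interpret L: subgroup "M \<inter> R" G by (rule MR(1))
  interpret M: subgroup M G using M(1) by (simp add: maximal_subgroup_def)
  have KL: "K \<subseteq> M \<inter> R" using MR(3) by blast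
  have "M \<inter> R \<lhd> G"
  proof (rule normal_if_set_mult[OF MR(1) N.subset M.subset maximal_subgroup_complement(1)[OF assms(1,2) M]])
    fix n a assume n: "n \<in> N" and a: "a \<in> M \<inter> R"
    have "n \<otimes> a \<otimes> inv n \<otimes> inv a \<in> M \<inter> R" using central[OF n, of a] a KL by blast
    then show "n \<otimes> a \<otimes> inv n \<in> M \<inter> R"
      using n by (intro conj_mem_if_commutator_mem[OF MR(1) a]) auto
  qed (rule MR(4))
  moreover have "M \<inter> R \<subset> R" using MR(3) KN NR by blast
  moreover have "Y = M \<inter> R \<or> Y = R" if Y: "Y \<lhd> G" "M \<inter> R \<subseteq> Y" "Y \<subseteq> R" for Y
  proof -
    interpret Y: normal Y G by (rule Y(1))
    have "N \<inter> Y = K \<or> N \<inter> Y = N"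
      by (rule chief[OF normal_subgroup_intersect[OF nN Y(1)]]) (use KN KL Y in auto)
    then show ?thesis
    proof
      assume "N \<inter> Y = N"
      then have "N <#> (M \<inter> R) \<subseteq> Y" using Y by (intro set_mult_least Y.is_subgroup) auto
      then show ?thesis using MR(2) Y(3) by auto
    next
      assume NY: "N \<inter> Y = K"
      have "Y = (N \<inter> Y) <#> (M \<inter> R)"
      proof
        show "(N \<inter> Y) <#> (M \<inter> R) \<subseteq> Y" using Y by (intro set_mult_least Y.is_subgroup) auto
        show "Y \<subseteq> (N \<inter> Y) <#> (M \<inter> R)"
        proof
          fix y assume y: "y \<in> Y"
          then have "y \<in> N <#> (M \<inter> R)" using MR(2) Y(3) by blast
          then obtain n l where nl: "n \<in> N" "l \<in> M \<inter> R" "y = n \<otimes> l" unfolding set_mult_def by blast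
          have "n = y \<otimes> inv l" using nl(1) L.mem_carrier[OF nl(2)] by (simp add: nl(3) m_assoc)
          then have "n \<in> Y" using y nl(2) Y(2) by (simp add: subsetD)
          then show "y \<in> (N \<inter> Y) <#> (M \<inter> R)" using nl unfolding set_mult_def by blast
        qed
      qed
      also have "\<dots> \<subseteq> M \<inter> R" unfolding NY by (rule set_mult_least[OF MR(1) KL subset_refl])
      finally show ?thesis using Y(2) by blast
    qed
  qed
  ultimately show ?thesis unfolding chief_factor_def using nR by blast
qed

text \<open>If \<open>S\<close> has two members, any two distinct ones meet exactly in
  \<open>K\<close>, so the sets \<open>L - K\<close> are disjoint subsets of \<open>R - N\<close>,
  and comparing sizes bounds \<open>card S\<close>. \<open>X\<close> lies in such an intersection,
  hence in \<open>K\<close>. If \<open>L0\<close> is the only member,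
  \<open>X \<subseteq> L0\<close> is enough.\<close>

lemma card_normal_complements:
  assumes "finite (carrier G)" "subgroup K G" "K \<subset> N" "chief_factor G N R"
    and S: "\<And>L. L \<in> S \<Longrightarrow> chief_factor G L R" "\<And>L. L \<in> S \<Longrightarrow> N <#> L = R"
      "\<And>L. L \<in> S \<Longrightarrow> L \<inter> N = K" "\<And>L. L \<in> S \<Longrightarrow> X \<subseteq> L"
    and L0: "L0 \<in> S"
  shows "card S * card X \<le> card L0"
proof -
  have nN: "N \<lhd> G" and nR: "R \<lhd> G" and NR: "N \<subset> R"
    and chief: "\<And>Y. Y \<lhd> G \<Longrightarrow> N \<subseteq> Y \<Longrightarrow> Y \<subseteq> R \<Longrightarrow> Y = N \<or> Y = R"
    using assms(4) unfolding chief_factor_def by blast+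
  interpret N: normal N G by fact
  interpret R: normal R G by fact
  interpret K: subgroup K G by fact
  have nL: "L \<lhd> G" and LR: "L \<subset> R" if "L \<in> S" for L
    using S(1)[OF that] unfolding chief_factor_def by blast+
  have finR: "finite R" using assms(1) R.subset finite_subset by blast
  have finL: "finite L" if "L \<in> S" for L using LR[OF that] finR finite_subset by blast
  have card_RK: "card R * card K = card N * card L" if "L \<in> S" for L
    using card_set_mult[OF assms(1) N.is_subgroup normal_imp_subgroup[OF nL[OF that]]]
      S(2,3)[OF that] by (simp add: Int_commute)
  have N_pos: "0 < card N" using N.finite_imp_card_positive[OF assms(1)] .
  have card_eq: "card L = card L0" if "L \<in> S" for L
    using card_RK[OF that] card_RK[OF L0] N_pos by simp
  show ?thesis
  proof (cases "S = {L0}")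
    case True
    then show ?thesis using card_mono[OF finL[OF L0] S(4)[OF L0]] by simp
  next
    case False
    then obtain L1 where L1: "L1 \<in> S" "L1 \<noteq> L0" using L0 by blast
    have disj: "L \<inter> L' = K" if LL: "L \<in> S" "L' \<in> S" "L \<noteq> L'" for L L'
    proof -
      define Y where "Y = L \<inter> L'"
      have Y: "Y \<lhd> G" unfolding Y_def using nL[OF LL(1)] nL[OF LL(2)] by (rule normal_subgroup_intersect)
      have KY: "K \<subseteq> Y" using S(3)[OF LL(1)] S(3)[OF LL(2)] by (auto simp: Y_def)
      note sY = normal_imp_subgroup[OF Y]
      have "N <#> Y \<subseteq> R"
        by (rule set_mult_least[OF R.is_subgroup]) (use NR LR[OF LL(1)] in \<open>auto simp: Y_def\<close>)
      then have "N <#> Y = N \<or> N <#> Y = R"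
        by (rule chief[OF normal_subgroup_set_mult_closed[OF nN Y] set_mult_subgroups(2)[OF nN sY]])
      \<comment> \<open>Otherwise the modular law gives
        \<open>L2 = (N \<inter> L2) <#> Y = K <#> Y \<subseteq> Y\<close> for both
        \<open>L2 = L\<close> and \<open>L2 = L'\<close>, which makes them equal.\<close>
      moreover have "N <#> Y \<noteq> R"
      proof
        assume "N <#> Y = R"
        have sub: "L2 \<subseteq> Y" if L2: "L2 \<in> S" "Y \<subseteq> L2" for L2
        proof -
          note sL2 = normal_imp_subgroup[OF nL[OF L2(1)]]
          have "(N <#> Y) \<inter> L2 = (N \<inter> L2) <#> Y"
          proof
            show "(N \<inter> L2) <#> Y \<subseteq> (N <#> Y) \<inter> L2"
              using set_mult_least[OF sL2 _ L2(2), of "N \<inter> L2"] mono_set_mult[of "N \<inter> L2" N Y Y] by auto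
            show "(N <#> Y) \<inter> L2 \<subseteq> (N \<inter> L2) <#> Y"
            proof
              fix x assume x: "x \<in> (N <#> Y) \<inter> L2"
              then obtain n y where ny: "n \<in> N" "y \<in> Y" "x = n \<otimes> y" unfolding set_mult_def by blast
              have "n = x \<otimes> inv y"
                using ny(1) subgroup.mem_carrier[OF sY ny(2)] by (simp add: ny(3) m_assoc)
              moreover have "x \<otimes> inv y \<in> L2"
                using x ny(2) L2(2) by (intro subgroup.m_closed[OF sL2] subgroup.m_inv_closed[OF sL2]) auto
              ultimately show "x \<in> (N \<inter> L2) <#> Y" using ny unfolding set_mult_def by blast
            qed
          qed
          then have "L2 = (N \<inter> L2) <#> Y" using \<open>N <#> Y = R\<close> LR[OF L2(1)] by auto
          also have "\<dots> \<subseteq> Y" using S(3)[OF L2(1)] KY by (intro set_mult_least[OF sY]) auto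
          finally show ?thesis .
        qed
        have "L = L'" using sub[OF LL(1)] sub[OF LL(2)] by (auto simp: Y_def)
        then show False using LL(3) by blast
      qed
      ultimately have "N <#> Y = N" by blast
      then have "Y \<subseteq> N" using set_mult_subgroups(3)[OF nN sY] by blast
      then show ?thesis using S(3)[OF LL(1)] KY by (auto simp: Y_def)
    qed
    have XK: "X \<subseteq> K" using disj[OF L1(1) L0 L1(2)] S(4)[OF L1(1)] S(4)[OF L0] by blast
    have "finite K" using assms(1) K.subset finite_subset by blast
    then have X_le: "card X \<le> card K" using XK by (rule card_mono)
    \<comment> \<open>Two distinct members are also complements of each other:
      \<open>L0 <#> L1 = R\<close> because \<open>R / L0\<close> is chief and groups of equal order
      cannot be properly contained in one another. Comparing the two product formulas for
      \<open>R\<close> gives the equality.\<close>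
    have NL0: "card N = card L0"
    proof -
      have "L0 <#> L1 = R"
      proof -
        have "L0 <#> L1 = L0 \<or> L0 <#> L1 = R"
          using S(1)[OF L0] normal_subgroup_set_mult_closed[OF nL[OF L0] nL[OF L1(1)]]
            set_mult_subgroups(2)[OF nL[OF L0] normal_imp_subgroup[OF nL[OF L1(1)]]]
            set_mult_least[OF R.is_subgroup, of L0 L1] LR[OF L0] LR[OF L1(1)]
          unfolding chief_factor_def by blast
        moreover have "\<not> L1 \<subseteq> L0"
          using card_subset_eq[OF finL[OF L0]] card_eq[OF L1(1)] L1(2) by blast
        ultimately show ?thesis
          using set_mult_subgroups(3)[OF nL[OF L0] normal_imp_subgroup[OF nL[OF L1(1)]]] by blast
      qed
      then have "card R * card K = card L0 * card L1"
        using card_set_mult[OF assms(1) normal_imp_subgroup[OF nL[OF L0]] normal_imp_subgroup[OF nL[OF L1(1)]]]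
          disj[OF L0 L1(1)] L1(2) by simp
      then have "card N * card L0 = card L0 * card L0" using card_RK[OF L0] card_eq[OF L1(1)] by simp
      moreover have "0 < card L0" 
        using subgroup.finite_imp_card_positive[OF normal_imp_subgroup[OF nL[OF L0]] assms(1)] .
      ultimately show ?thesis by simp
    qed
    have KL0: "K \<subseteq> L0" using S(3)[OF L0] by blast
    have "card K < card N" using assms(1,3) N.subset by (intro psubset_card_mono) (auto intro: finite_subset)
    have finS: "finite S" by (rule finite_subset[of _ "Pow R"]) (use LR finR in auto)
    have KL: "K \<subseteq> L" if "L \<in> S" for L using S(3)[OF that] by blast
    have "card (\<Union>L\<in>S. L - K) = (\<Sum>L\<in>S. card (L - K))"
      by (rule card_UN_disjoint) (use finS finL disj in auto)
    also have "\<dots> = (\<Sum>L\<in>S. card L0 - card K)"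
      using card_Diff_subset[OF \<open>finite K\<close> KL] card_eq by simp
    finally have "card S * (card L0 - card K) = card (\<Union>L\<in>S. L - K)" by simp
    also have "\<dots> \<le> card (R - N)"
      by (rule card_mono) (use finR LR S(3) in auto)
    also have "\<dots> = card R - card N" using NR finR by (intro card_Diff_subset) (auto intro: finite_subset)
    finally have "card S * (card L0 - card K) * card K \<le> (card R - card N) * card K" by simp
    also have "\<dots> = card N * (card L0 - card K)"
      using card_RK[OF L0] by (simp add: diff_mult_distrib diff_mult_distrib2)
    finally have "card S * card K * (card L0 - card K) \<le> card L0 * (card L0 - card K)"
      unfolding NL0 by (simp add: ac_simps)
    then have "card S * card K \<le> card L0" using \<open>card K < card N\<close> NL0 by simp
    then show ?thesis using X_le by (meson le_trans mult_le_mono2)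
  qed
qed

section \<open>The bound for a single chief factor\<close>

text \<open>If a complement containing \<open>H\<close> exists, then
  \<open>H \<inter> N = K\<close>, and the inequality is the bound \<open>|G : H| - |G : HN|\<close>
  with denominators cleared. The induction replaces \<open>K\<close> by a larger normal subgroup
  instead of passing to a quotient of \<open>G\<close>.\<close>

lemma card_maximal_complements:
  assumes "finite (carrier G)" "solvable G" "chief_factor G K N" "subgroup H G" "K \<subseteq> H"
  shows "card {M. maximal_subgroup M G \<and> H \<subseteq> M \<and> \<not> N \<subseteq> M} * card H * card N
    \<le> order G * (card N - card K)"
  using assms(3-)
proof (induction "order G - card K" arbitrary: K N H rule: less_induct)
  case less
  define C where "C = {M. maximal_subgroup M G \<and> H \<subseteq> M \<and> \<not> N \<subseteq> M}"
  note KN = less.prems(1) and H = less.prems(2) and KH = less.prems(3)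
  have nK: "K \<lhd> G" and nN: "N \<lhd> G" and sKN: "K \<subset> N"
    using KN unfolding chief_factor_def by blast+
  interpret K: normal K G by fact
  interpret N: normal N G by fact
  interpret H: subgroup H G by fact
  have fin: "finite A" if "A \<subseteq> carrier G" for A using assms(1) that by (rule finite_subset[rotated])
  have CD: "maximal_subgroup M G" "K \<subseteq> M" "\<not> N \<subseteq> M" "H \<subseteq> M" "subgroup M G" if "M \<in> C" for M
    using that KH by (auto simp: C_def maximal_subgroup_def)
  note K_pos = K.finite_imp_card_positive[OF assms(1)]
  have KN2: "2 * card K \<le> card N"
    using double_card_le_subgroup[OF assms(1) K.is_subgroup N.is_subgroup sKN] .
  have finC: "finite C"
    by (rule finite_subset[of _ "Pow (carrier G)"]) (use CD(5) subgroup.subset assms(1) in auto)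
  have compl: "N <#> M = carrier G" "M \<inter> N = K" "order G * card K = card N * card M" if "M \<in> C" for M
  proof -
    show *: "N <#> M = carrier G" "M \<inter> N = K"
      using maximal_subgroup_complement[OF assms(2) KN CD(1-3)[OF that]] .
    show "order G * card K = card N * card M"
      using card_set_mult[OF assms(1) N.is_subgroup CD(5)[OF that]] *
      by (simp add: order_def Int_commute)
  qed
  have "card C * card H * card N \<le> order G * (card N - card K)"
  proof (cases "C = {}")
    case True
    then show ?thesis by simp
  next
    case False
    then obtain M0 where M0: "M0 \<in> C" by blast
    show ?thesis
    proof (cases "H \<in> C")
      case True
      \<comment> \<open>A maximal \<open>H\<close> is the only candidate, and
        \<open>card K \<le> card N - card K\<close> settles this case.\<close>
      have "M = H" if "M \<in> C" for M
        using CD(1)[OF True] CD(1,4,5)[OF that] unfolding maximal_subgroup_def by blast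
      then have "C = {H}" using True by blast
      then have "card C * card H * card N = order G * card K" using compl(3)[OF True] by simp
      also have "\<dots> \<le> order G * (card N - card K)" using KN2 by (intro mult_le_mono2) simp
      finally show ?thesis .
    next
      case False
      have HM0: "H \<subset> M0" using CD(4)[OF M0] False M0 by blast
      \<comment> \<open>With \<open>N = G\<close> the complement \<open>M0\<close> would equal
        \<open>K \<subseteq> H\<close>, against \<open>H \<subset> M0\<close>. Hence there is a next
        chief factor.\<close>
      have "N \<noteq> carrier G"
        using compl(2)[OF M0] HM0 KH subgroup.subset[OF CD(5)[OF M0]] by blast
      then obtain R where NR: "chief_factor G N R" using chief_factor_exists[OF assms(1) nN] by blast
      then have nR: "R \<lhd> G" and sNR: "N \<subset> R" unfolding chief_factor_def by blast+
      interpret R: normal R G by fact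
      show ?thesis
      proof (cases "\<forall>n\<in>N. \<forall>r\<in>R. n \<otimes> r \<otimes> inv n \<otimes> inv r \<in> K")
        case False
        then obtain n r where "n \<in> N" "r \<in> R" "n \<otimes> r \<otimes> inv n \<otimes> inv r \<notin> K" by blast
        then have "card {M. maximal_subgroup M G \<and> K \<subseteq> M \<and> \<not> N \<subseteq> M} * card K \<le> card N"
          using card_maximal_complements_noncentral[OF assms(1,2) KN NR] by blast
        moreover have "finite {M. maximal_subgroup M G \<and> K \<subseteq> M \<and> \<not> N \<subseteq> M}"
          by (rule finite_subset[of _ "Pow (carrier G)"])
            (use subgroup.subset assms(1) in \<open>auto simp: maximal_subgroup_def\<close>)
        then have "card C \<le> card {M. maximal_subgroup M G \<and> K \<subseteq> M \<and> \<not> N \<subseteq> M}"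
          by (rule card_mono) (use CD in auto)
        ultimately have cK: "card C * card K \<le> card N" by (meson le_trans mult_le_mono1)
        \<comment> \<open>The noncentral bound leaves \<open>card N\<close> where
          \<open>card N - card K\<close> is wanted, a loss of at most a factor 2; it is regained
          because \<open>H\<close> is proper in \<open>M0\<close>.\<close>
        have H2: "2 * card H \<le> card M0"
          using double_card_le_subgroup[OF assms(1) H CD(5)[OF M0] HM0] .
        have "card C * card H * card N * card K = (card C * card K) * (card H * card N)"
          by (simp only: ac_simps)
        also have "\<dots> \<le> card N * (card H * card N)" using cK by (rule mult_le_mono1)
        also have "\<dots> \<le> card N * (card H * (2 * (card N - card K)))"
          using KN2 by (intro mult_le_mono2) simp
        also have "\<dots> = card N * (2 * card H) * (card N - card K)" by (simp only: ac_simps)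
        also have "\<dots> \<le> card N * card M0 * (card N - card K)"
          using H2 by (intro mult_le_mono1 mult_le_mono2)
        also have "\<dots> = order G * (card N - card K) * card K"
          unfolding compl(3)[OF M0, symmetric] by (simp only: ac_simps)
        finally show ?thesis using K_pos by simp
      next
        case True
        define S where "S = (\<lambda>M. M \<inter> R) ` C"
        \<comment> \<open>\<open>D L\<close> collects the complements of the chief factor
          \<open>R / L\<close> that contain \<open>L <#> H\<close>. Each \<open>M \<in> C\<close>
          belongs to \<open>D (M \<inter> R)\<close>, and the induction hypothesis bounds each
          \<open>D L\<close>.\<close>
        define D where "D L = {M. maximal_subgroup M G \<and> L <#> H \<subseteq> M \<and> \<not> R \<subseteq> M}" for L
        define L0 where "L0 = M0 \<inter> R"
        have L0: "L0 \<in> S" using M0 by (simp add: S_def L0_def)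
        have chiefS: "chief_factor G L R" "N <#> L = R" "L \<inter> N = K" "L \<inter> H = H \<inter> R" if L: "L \<in> S" for L
        proof -
          obtain M where M: "M \<in> C" "L = M \<inter> R" using L by (auto simp: S_def)
          show "chief_factor G L R" unfolding M(2)
            by (rule central_complement_chief_factor[OF assms(2) KN NR _ CD(1-3)[OF M(1)]]) (use True in blast)
          show "N <#> L = R" "L \<inter> N = K"
            unfolding M(2) using maximal_subgroup_Int_factor[OF assms(2) KN NR CD(1-3)[OF M(1)]] by auto
          show "L \<inter> H = H \<inter> R" unfolding M(2) using CD(4)[OF M(1)] by blast
        qed
        have nL: "L \<lhd> G" and LR: "L \<subset> R" if "L \<in> S" for L
          using chiefS(1)[OF that] unfolding chief_factor_def by blast+
        have card_RK: "card R * card K = card N * card L" if "L \<in> S" for L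
          using card_set_mult[OF assms(1) N.is_subgroup normal_imp_subgroup[OF nL[OF that]]]
            chiefS(2,3)[OF that] by (simp add: Int_commute)
        have N_pos: "0 < card N" using N.finite_imp_card_positive[OF assms(1)] .
        have card_eq: "card L = card L0" if "L \<in> S" for L
          using card_RK[OF that] card_RK[OF L0] N_pos by simp
        have "card N < card R" using sNR fin[OF R.subset] by (rule psubset_card_mono[rotated])
        then have "card N * card K < card N * card L0" using card_RK[OF L0] K_pos by (metis mult_less_cancel2)
        then have KL0: "card K < card L0" by simp
        \<comment> \<open>Multiplying the induction hypothesis by \<open>card (H \<inter> R)\<close>
          removes \<open>L <#> H\<close>, since \<open>L \<inter> H = H \<inter> R\<close>. The
          resulting bound is the same for every \<open>L\<close>, so the sum over \<open>S\<close>
          becomes a multiple of \<open>card S\<close>.\<close>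
        have step: "card (D L) * (card L0 * card H * card R) \<le> order G * (card R - card L0) * card (H \<inter> R)"
          if L: "L \<in> S" for L
        proof -
          have sL: "subgroup L G" using nL[OF L] by (rule normal_imp_subgroup)
          have "card L0 \<le> order G"
            unfolding order_def card_eq[OF L, symmetric] using assms(1) subgroup.subset[OF sL] by (rule card_mono)
          then have lt: "order G - card L < order G - card K" using KL0 card_eq[OF L] by simp
          have "card (D L) * card (L <#> H) * card R \<le> order G * (card R - card L)"
            unfolding D_def
            by (rule less.hyps[OF lt chiefS(1)[OF L] set_mult_subgroups(1,2)[OF nL[OF L] H]])
          then have "card (D L) * card (L <#> H) * card R * card (H \<inter> R)
              \<le> order G * (card R - card L0) * card (H \<inter> R)"
            unfolding card_eq[OF L] by (rule mult_le_mono1)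
          moreover have "card (L <#> H) * card (H \<inter> R) = card L0 * card H"
            using card_set_mult[OF assms(1) sL H] chiefS(4)[OF L] card_eq[OF L] by simp
          then have "card (D L) * card (L <#> H) * card R * card (H \<inter> R) = card (D L) * (card L0 * card H * card R)"
            by (metis mult.assoc mult.commute)
          ultimately show ?thesis by simp
        qed
        have finS: "finite S" using finC by (simp add: S_def)
        have finD: "finite (D L)" for L
          by (rule finite_subset[of _ "Pow (carrier G)"])
            (use subgroup.subset assms(1) in \<open>auto simp: maximal_subgroup_def D_def\<close>)
        have "C \<subseteq> (\<Union>L\<in>S. D L)"
        proof
          fix M assume M: "M \<in> C"
          have "(M \<inter> R) <#> H \<subseteq> M" using CD(4,5)[OF M] by (intro set_mult_least) auto
          moreover have "\<not> R \<subseteq> M" using CD(3)[OF M] sNR by blast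
          ultimately have "M \<in> D (M \<inter> R)" using CD(1)[OF M] by (simp add: D_def)
          then show "M \<in> (\<Union>L\<in>S. D L)" using M by (auto simp: S_def)
        qed
        then have "card C \<le> card (\<Union>L\<in>S. D L)" using finS finD by (intro card_mono) auto
        also have "\<dots> \<le> (\<Sum>L\<in>S. card (D L))" by (rule card_UN_le[OF finS])
        finally have "card C * (card L0 * card H * card R)
            \<le> (\<Sum>L\<in>S. card (D L)) * (card L0 * card H * card R)" by (rule mult_le_mono1)
        also have "\<dots> = (\<Sum>L\<in>S. card (D L) * (card L0 * card H * card R))" by (rule sum_distrib_right)
        also have "\<dots> \<le> (\<Sum>L\<in>S. order G * (card R - card L0) * card (H \<inter> R))"
          by (rule sum_mono) (rule step)
        finally have "card C * (card L0 * card H * card R)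
            \<le> card S * (order G * (card R - card L0) * card (H \<inter> R))" by simp
        \<comment> \<open>Every \<open>L \<in> S\<close> contains \<open>H \<inter> R\<close>, which
          takes the role of \<open>X\<close>.\<close>
        moreover have "card S * card (H \<inter> R) \<le> card L0"
          by (rule card_normal_complements[OF assms(1) K.is_subgroup sKN NR chiefS(1-3) _ L0])
            (use chiefS(4) in auto)
        ultimately show ?thesis
          by (rule mult_le_by_cancel[OF _ _ card_RK[OF L0]]) (use KL0 in simp)
      qed
    qed
  qed
  then show ?case by (simp add: C_def)
qed

section \<open>Summation along a chief series\<close>

text \<open>For a chief factor \<open>N / K\<close>, the maximal subgroups above \<open>H\<close>
  either contain \<open>N\<close>, hence \<open>N <#> H\<close>, and are counted by induction with
  \<open>N\<close> in place of \<open>K\<close>, or they complement the factor. The bounds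
  \<open>|G : HN| - 1\<close> and \<open>|G : H| - |G : HN|\<close> add up.\<close>

lemma card_maximal_supergroups:
  assumes "finite (carrier G)" "solvable G" "K \<lhd> G" "subgroup H G" "K \<subseteq> H"
  shows "card {M. maximal_subgroup M G \<and> H \<subseteq> M} * card H < order G"
  using assms(3-)
proof (induction "order G - card K" arbitrary: K H rule: less_induct)
  case less
  note nK = less.prems(1) and H = less.prems(2) and KH = less.prems(3)
  interpret K: normal K G by (rule nK)
  interpret H: subgroup H G by (rule H)
  have order_pos: "0 < order G" using assms(1) order_gt_0_iff_finite by blast
  show ?case
  proof (cases "K = carrier G")
    case True
    \<comment> \<open>At the top of the series \<open>H\<close> is all of \<open>G\<close>; the
      strict inequality originates here, as \<open>0 < order G\<close>.\<close>
    have no_max: "{M. maximal_subgroup M G \<and> H \<subseteq> M} = {}"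
      using True KH subgroup.subset unfolding maximal_subgroup_def by blast
    show ?thesis unfolding no_max using order_pos by simp
  next
    case False
    then obtain N where KN: "chief_factor G K N" using chief_factor_exists[OF assms(1) nK] by blast
    then have nN: "N \<lhd> G" and sKN: "K \<subset> N" unfolding chief_factor_def by blast+
    interpret N: normal N G by (rule nN)
    define A where "A = {M. maximal_subgroup M G \<and> N <#> H \<subseteq> M}"
    define C where "C = {M. maximal_subgroup M G \<and> H \<subseteq> M \<and> \<not> N \<subseteq> M}"
    note NH = set_mult_subgroups[OF nN H]
    have fin: "finite X" if "X \<subseteq> {M. maximal_subgroup M G}" for X
      by (rule finite_subset[of _ "Pow (carrier G)"])
        (use that subgroup.subset assms(1) in \<open>auto simp: maximal_subgroup_def\<close>)
    have NH_le: "N <#> H \<subseteq> M \<longleftrightarrow> N \<subseteq> M \<and> H \<subseteq> M" if "maximal_subgroup M G" for M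
    proof -
      have "subgroup M G" using that by (simp add: maximal_subgroup_def)
      from set_mult_least[OF this, of N H] show ?thesis using NH(2,3) by blast
    qed
    have "{M. maximal_subgroup M G \<and> H \<subseteq> M} = A \<union> C"
      using NH_le by (auto simp: A_def C_def)
    moreover have "A \<inter> C = {}" using NH(2) unfolding A_def C_def by blast
    ultimately have card_AC: "card {M. maximal_subgroup M G \<and> H \<subseteq> M} = card A + card C"
      by (simp only:) (intro card_Un_disjoint fin, auto simp: A_def C_def)
    have "card K < card N" using assms(1) N.subset sKN by (intro psubset_card_mono) (auto intro: finite_subset)
    moreover have "card N \<le> order G" unfolding order_def using assms(1) N.subset by (rule card_mono)
    ultimately have "order G - card N < order G - card K" by simp
    then have IH: "card A * card (N <#> H) < order G"
      unfolding A_def by (rule less.hyps[OF _ nN NH(1,2)])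
    show ?thesis
    proof (cases "C = {}")
      case True
      have "card H \<le> card (N <#> H)"
        using NH(3) assms(1) subgroup.subset[OF NH(1)] by (intro card_mono) (auto intro: finite_subset)
      then have "card A * card H \<le> card A * card (N <#> H)" by (rule mult_le_mono2)
      also note IH
      finally show ?thesis using card_AC True by simp
    next
      case False
      then obtain M where M: "maximal_subgroup M G" "H \<subseteq> M" "\<not> N \<subseteq> M" by (auto simp: C_def)
      \<comment> \<open>A complement containing \<open>H\<close> forces this intersection, so
        \<open>card (N <#> H)\<close> can be expressed by \<open>card H\<close>,
        \<open>card N\<close> and \<open>card K\<close>, and the two bounds can be added after
        multiplying by \<open>card N\<close>.\<close>
      have "N \<inter> H = K"
        using maximal_subgroup_complement(2)[OF assms(2) KN M(1) _ M(3)] M(2) KH sKN by blast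
      then have card_NH: "card (N <#> H) * card K = card N * card H"
        using card_set_mult[OF assms(1) N.is_subgroup H] by simp
      have "(card A + card C) * card H * card N
          = card A * (card N * card H) + card C * card H * card N"
        by (simp add: algebra_simps)
      also have "\<dots> = card A * card (N <#> H) * card K + card C * card H * card N"
        unfolding card_NH[symmetric] by simp
      also have "\<dots> < order G * card K + order G * (card N - card K)"
        using IH K.finite_imp_card_positive[OF assms(1)]
          card_maximal_complements[OF assms(1,2) KN H KH, folded C_def]
        by (intro add_less_le_mono) simp_all
      also have "\<dots> = order G * card N"
        using \<open>card K < card N\<close> by (simp flip: distrib_left)
      finally show ?thesis unfolding card_AC by simp
    qed
  qed
qed

end

theorem corollaryA9:
  fixes G :: "('a, 'b) monoid_scheme" and H :: "'a set"
  assumes "group G"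
    and "finite (carrier G)"
    and "solvable G"
    and "subgroup H G"
  shows "real (card {M. maximal_subgroup M G \<and> H \<subset> M}) < real (order G) / real (card H)"
proof -
  interpret group G by fact
  have H_pos: "0 < card H" using subgroup.finite_imp_card_positive[OF assms(4,2)] .
  have "{M. maximal_subgroup M G \<and> H \<subseteq> M} \<subseteq> Pow (carrier G)"
    using subgroup.subset by (auto simp: maximal_subgroup_def)
  then have "finite {M. maximal_subgroup M G \<and> H \<subseteq> M}" using assms(2) by (simp add: finite_subset)
  then have "card {M. maximal_subgroup M G \<and> H \<subset> M} \<le> card {M. maximal_subgroup M G \<and> H \<subseteq> M}"
    by (rule card_mono) auto
  then have "card {M. maximal_subgroup M G \<and> H \<subset> M} * card H
      \<le> card {M. maximal_subgroup M G \<and> H \<subseteq> M} * card H"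
    by (rule mult_le_mono1)
  \<comment> \<open>The chief series starts at the trivial subgroup, which lies in every
    \<open>H\<close>.\<close>
  also have "\<dots> < order G"
    by (rule card_maximal_supergroups[OF assms(2,3) one_is_normal assms(4)])
      (simp add: subgroup.one_closed[OF assms(4)])
  finally show ?thesis using H_pos by (simp add: pos_less_divide_eq flip: of_nat_mult)
qed

end
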